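(* Let $Z\sim \mathrm{Normal}(0,1)$, let $\Phi$ denote the cumulative distribution function of $Z$, and let $F$ denote the cumulative distribution function of the $\mathrm{Binomial}(m,1/2)$ distribution. Let $m$ be a natural number satisfying $\sqrt{2\pi}\, 20^6\, m^{-1} \leq \sqrt{\log m}$ (for example, $m\geq 4\cdot 10^7$ works). If $$Y_m = \frac{m}{2} + \frac{\sqrt{m}}{2} Z \sim \mathrm{Normal}(m/2, m/4) \quad\text{and}\quad X_m := F^{\star}(\Phi(Z)) \sim \mathrm{Binomial}(m,1/2),$$ then $$\left|X_m - Y_m - \frac{Z - Z^3}{24\sqrt{m}}\right| \leq \frac{1}{2} + \frac{2\cdot 20^6}{m}, \quad \text{for } |Z| \leq \sqrt{\log m}.$$ In particular, we also have the (weaker) estimate $$|X_m - Y_m| \leq \frac{1}{2} + \frac{1}{24}\sqrt{\frac{\log m}{m}} + \frac{1}{24}\cdot\frac{|Z|^3}{\sqrt{m}} + \frac{2\cdot 20^6}{m}, \quad \text{for } |Z| \leq \sqrt{\log m}.$$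
   Context: $F^{\star}(p) := \inf\{x\in\mathbb{R} : F(x)\geq p\}$ denotes the generalized inverse distribution function (quantile function) associated with $F$. $\log$ is the natural logarithm. $\mathrm{Normal}(\mu,v)$ is the normal distribution with mean $\mu$ and variance $v$. *)

theory Defs
  imports "HOL-Probability.Probability"
begin

(* Real-valued Inf: for a distribution function F this is the generalized inverse when 0 < p < 1;
   for other p the set may be empty or unbounded below, and the value is then unspecified. *)
definition quantile :: "(real \<Rightarrow> real) \<Rightarrow> real \<Rightarrow> real" where
  "quantile F p = Inf {x. F x \<ge> p}"

definition binomial_law :: "nat \<Rightarrow> real \<Rightarrow> real measure" where
  "binomial_law n p = distr (measure_pmf (binomial_pmf n p)) borel real"

end

theory Submission
  imports Defs "HOL-Real_Asymp.Real_Asymp"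
begin

text \<open>
  Put \<open>N = (m + 1) / 2\<close> and measure positions in the scale \<open>v = (x - m / 2) * sqrt (2 / N)\<close>. The parameter
  \<open>N\<close> is more natural than \<open>m / 2\<close> because the binomial mass at \<open>m / 2 + s + 1 / 2\<close> divided by the mass at
  \<open>m / 2 + s - 1 / 2\<close> is exactly \<open>(N - s) / (N + s)\<close>.

  The quantile coupling gives \<open>X = k\<close> exactly when \<open>F (k - 1) < \<Phi> Z \<le> F k\<close>. Let
  \<open>T z = m / 2 + sqrt m / 2 * z + (z - z^3) / (24 * sqrt m)\<close>. The claim says that \<open>X\<close> differs from \<open>T Z\<close> by
  little more than half a lattice step, so it compares \<open>F k\<close> with \<open>\<Phi>\<close> at the point which \<open>T\<close> sends to
  \<open>k + 1 / 2\<close>. In the scale of \<open>v\<close> the map \<open>T\<close> is inverted, with an error of order \<open>1 / N^2\<close>, by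
  \<open>S v = v + (5 * v + v^3) / (24 * N)\<close> (\<open>inverse_transport_transport\<close>). The heart of the proof is the
  uniform additive estimate \<open>\<bar>F k - \<Phi> (S v)\<bar> \<le> 33000 / N^2\<close> for \<open>v = (k + 1 / 2 - m / 2) * sqrt (2 / N)\<close>
  and \<open>v^4 \<le> N\<close> (\<open>sym_binom_cdf_normal\<close>).

  This estimate suffices for the following reason. For \<open>\<bar>z\<bar> \<le> sqrt (ln m)\<close> the normal density is at least of
  order \<open>1 / sqrt m\<close>. A shift of the lattice point by \<open>\<epsilon> = 2 * 20^6 / m\<close> moves \<open>z\<close> by an amount of order
  \<open>20^6 / m powr (3/2)\<close>, and hence \<open>\<Phi> z\<close> by an amount of order \<open>20^6 / m^2\<close>. That exceeds
  \<open>33000 / N^2\<close> (\<open>sym_binom_cdf_vs_transport\<close>), so the two distribution functions are ordered correctly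
  once the lattice point is shifted by \<open>\<epsilon>\<close> in either direction.

  For the uniform estimate, the binomial masses are compared one by one with the increments of
  \<open>G v = \<Phi> v + (5 * v + v^3) * \<phi> v / (24 * N)\<close> over the lattice cells (\<open>sym_binom_cell\<close>). The logarithm of a
  mass is obtained from the central one by summing the logarithms of the ratios (\<open>ln_sym_binom_bound\<close>), and the
  central mass is known from Wallis' product (\<open>ln_central_prob_bounds\<close>). Each cell contributes an error bounded by
  a constant times its width times \<open>1 / (N^2 * (1 + v^2))\<close>. These bounds have a sum of order \<open>1 / N^2\<close>
  (\<open>cell_weight_telescopes\<close>), and summation starts at the centre, where symmetry fixes both functions.
\<close>

section \<open>The central binomial coefficient\<close>

text \<open>
  Since consecutive central binomial probabilities have the ratio \<open>(2x+1) / (2x+2)\<close>, the function \<open>\<beta>\<close> is the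
  increment over \<open>[x, x+1]\<close> of the quantity bounded in \<open>ln_central_prob_bounds\<close>. It increases to \<open>0\<close> at infinity,
  while \<open>\<beta> x + (1/x^2 - 1/(x+1)^2)/48\<close> decreases to \<open>0\<close>.
\<close>
lemma ln_central_step:
  fixes x :: real assumes "x \<ge> 1"
  defines "\<beta> \<equiv> \<lambda>x::real. ln (2*x+1) - ln (2*x+2) + (ln (x+1) - ln x)/2 + 1/(8*(x+1)) - 1/(8*x)"
  shows "\<beta> x \<le> 0" "\<beta> x \<ge> - (1/x^2 - 1/(x+1)^2)/48"
proof -
  have d: "(\<beta> has_real_derivative 1 / (16 * (x+1/2) * (x*(x+1))^2)) (at x)" if "x > 0" for x :: real
  proof -
    have "(\<beta> has_real_derivative
       (2/(2*x+1) - 1/(x+1) + (1/(x+1) - 1/x)/2 - 1/(8*(x+1)^2) + 1/(8*x^2))) (at x)"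
    proof -
      have a1: "((\<lambda>x::real. ln (2*x+1)) has_real_derivative 2/(2*x+1)) (at x)"
        using that by (auto intro!: derivative_eq_intros)
      have a2: "((\<lambda>x::real. ln (2*x+2)) has_real_derivative 1/(x+1)) (at x)"
        using that by (auto intro!: derivative_eq_intros simp: divide_simps)
      have a3: "((\<lambda>x::real. ln (x+1)) has_real_derivative 1/(x+1)) (at x)"
        using that by (auto intro!: derivative_eq_intros)
      have a4: "((\<lambda>x::real. ln x) has_real_derivative 1/x) (at x)"
        using that by (auto intro!: derivative_eq_intros)
      have a5: "((\<lambda>x::real. 1/(8*(x+1))) has_real_derivative -(1/(8*(x+1)^2))) (at x)"
        using that by (auto intro!: derivative_eq_intros simp: divide_simps power2_eq_square) (simp add: algebra_simps)
      have a6: "((\<lambda>x::real. 1/(8*x)) has_real_derivative -(1/(8*x^2))) (at x)"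
        using that by (auto intro!: derivative_eq_intros simp: divide_simps power2_eq_square)
      show ?thesis unfolding \<beta>_def
        using DERIV_diff[OF DERIV_add[OF DERIV_add[OF DERIV_diff[OF a1 a2] 
            DERIV_cdivide[OF DERIV_diff[OF a3 a4], of 2]] a5] a6] by simp
    qed
    also have "(2/(2*x+1) - 1/(x+1) + (1/(x+1) - 1/x)/2 - 1/(8*(x+1)^2) + 1/(8*x^2))
       = 1 / (16 * (x+1/2) * (x*(x+1))^2)"
    proof -
      have "2*x+1 \<noteq> 0" "x+1 \<noteq> 0" "x \<noteq> 0" "16 * (x+1/2) = 8*(2*x+1)" using that by auto
      thus ?thesis
        by (simp add: divide_simps) algebra
    qed
    finally show ?thesis .
  qed
  have l: "(\<beta> \<longlongrightarrow> 0) at_top" unfolding \<beta>_def by real_asymp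
  have "0 < - \<beta> x"
  proof (rule DERIV_neg_imp_decreasing_at_top[where f="\<lambda>x. - \<beta> x"])
    show "((\<lambda>x. - \<beta> x) \<longlongrightarrow> 0) at_top" using tendsto_minus[OF l] by simp
    fix y assume "x \<le> y"
    with assms have "y > 0" by simp
    thus "\<exists>z. ((\<lambda>x. - \<beta> x) has_real_derivative z) (at y) \<and> z < 0"
      by (intro exI conjI) (rule DERIV_minus[OF d], auto intro!: divide_pos_pos mult_pos_pos add_pos_pos)
  qed
  thus "\<beta> x \<le> 0" by simp
  define \<gamma> where "\<gamma> = (\<lambda>x. \<beta> x + (1/x^2 - 1/(x+1)^2)/48)"
  have l2: "(\<gamma> \<longlongrightarrow> 0) at_top" unfolding \<gamma>_def \<beta>_def by real_asymp
  have "0 < \<gamma> x"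
  proof (rule DERIV_neg_imp_decreasing_at_top[OF _ l2])
    fix y assume "x \<le> y"
    with assms have y: "y \<ge> 1" by simp
    have e1: "((\<lambda>x::real. 1/x^2) has_real_derivative - (2/y^3)) (at y)"
      using y by (auto intro!: derivative_eq_intros simp: divide_simps) (simp_all add: eval_nat_numeral algebra_simps)
    have e2: "((\<lambda>x::real. 1/(x+1)^2) has_real_derivative - (2/(y+1)^3)) (at y)"
      using y by (auto intro!: derivative_eq_intros simp: divide_simps) (simp_all add: eval_nat_numeral algebra_simps)
    have "((\<lambda>x::real. (1/x^2 - 1/(x+1)^2)/48) has_real_derivative (2/(y+1)^3 - 2/y^3)/48) (at y)"
      using DERIV_cdivide[OF DERIV_diff[OF e1 e2], of 48] by (simp add: algebra_simps)
    hence "(\<gamma> has_real_derivative (1 / (16 * (y+1/2) * (y*(y+1))^2) + (2/(y+1)^3 - 2/y^3)/48)) (at y)"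
      unfolding \<gamma>_def using DERIV_add[OF d[of y]] y by auto
    moreover have "1 / (16 * (y+1/2) * (y*(y+1))^2) + (2/(y+1)^3 - 2/y^3)/48 < 0"
    proof -
      have aux: "s + (q - p)/48 < 0" if "r < (p - q)/48" "s \<le> r" for p q r s :: real
        using that by (simp add: diff_divide_distrib)
      define A where "A = y*(y+1)"
      have A: "A > 0" using y by (simp add: A_def)
      have "2/y^3 - 2/(y+1)^3 = 2*(3*A+1)/A^3" 
        using y unfolding A_def by (simp add: divide_simps) algebra
      also have "\<dots> > 2*(3*A)/A^3" using A by (intro divide_strict_right_mono) auto
      also have "2*(3*A)/A^3 = 6/A^2" using A by (simp add: power2_eq_square power3_eq_cube)
      finally have "(2/y^3 - 2/(y+1)^3)/48 > 1/(8*A^2)" by simp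
      moreover have "1 / (16 * (y+1/2) * A^2) \<le> 1/(8*A^2)"
        using A y by (intro divide_left_mono mult_right_mono) auto
      ultimately have "1 / (16 * (y+1/2) * A^2) + (2/(y+1)^3 - 2/y^3)/48 < 0"
        by (rule aux)
      thus ?thesis unfolding A_def .
    qed
    ultimately show "\<exists>z. (\<gamma> has_real_derivative z) (at y) \<and> z < 0" by blast
  qed
  thus "\<beta> x \<ge> - (1/x^2 - 1/(x+1)^2)/48" unfolding \<gamma>_def by argo
qed

text \<open>
  This is the mass at \<open>n\<close> of the symmetric binomial law with \<open>2 n\<close> trials and also of the one with
  \<open>2 n - 1\<close> trials, which allows both parities of \<open>m\<close> to share one asymptotic expansion.
\<close>
definition central_prob :: "nat \<Rightarrow> real" where
  "central_prob n = real ((2*n) choose n) / 4^n"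

lemma central_prob_pos: "central_prob n > 0"
  by (simp add: central_prob_def)

lemma central_prob_Suc: "central_prob (Suc n) = central_prob n * ((2*real n+1)/(2*real n+2))"
proof -
  have b: "real ((2*n) choose n) = fact (2*n) / (fact n * fact n)" for n
    by (subst binomial_fact) auto
  have alg: "(2*c*a*F) / ((c*f)*(c*f)) / (4*p) = F/(f*f)/p * (a/(2*c))" if "c > 0" for a c f F p :: real
    using that by simp
  have 1: "fact (2 * Suc n) = 2*(real n+1) * (2*real n+1) * fact (2*n)"
    by (simp add: algebra_simps)
  have 2: "fact (Suc n) = (real n + 1) * fact n" by simp
  have 3: "2*real n + 2 = 2 * (real n + 1)" by simp
  show ?thesis unfolding central_prob_def b 1 2 3 power_Suc by (rule alg) simp
qed

lemma central_prob_wallis: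
  "(\<Prod>k=1..n. (4*real k^2) / (4*real k^2 - 1)) = 1 / (central_prob n ^ 2 * (2 * real n + 1))"
proof (induction n)
  case 0 show ?case by (simp add: central_prob_def)
next
  case (Suc n)
  have alg: "1 / (p^2 * (2*u+1)) * (4*(u+1)^2/(4*(u+1)^2-1)) = 1 / ((p * ((2*u+1)/(2*u+2)))^2 * (2*u+3))"
    if "p > 0" "u \<ge> 0" for p u :: real
  proof -
    have *: "1 / (p^2 * a) * (4*c^2/(a*b)) = 1 / ((p * (a/(2*c)))^2 * b)"
      if "a > 0" "b > 0" "c > 0" for a b c :: real
    proof -
      have "(p * (a/(2*c)))^2 * b = (p^2 * a) * (a*b) / (4*c^2)"
        by (simp only: power_mult_distrib power_divide power2_eq_square) simp
      thus ?thesis by (simp only: times_divide_eq_right times_divide_eq_left divide_divide_eq_left divide_divide_eq_right mult_1_left mult_1_right)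
    qed
    have "4 * (u+1)^2 - 1 = (2*u+1) * (2*u+3)" "2*u+2 = 2*(u+1)"
      by (simp_all add: power2_eq_square algebra_simps)
    thus ?thesis using *[of "2*u+1" "2*u+3" "u+1"] that by simp
  qed
  have "(\<Prod>k=1..Suc n. (4*real k^2) / (4*real k^2 - 1))
      = 1 / (central_prob n ^ 2 * (2 * real n + 1)) * (4*(real n+1)^2/(4*(real n+1)^2-1))"
    using Suc by (simp add: add.commute)
  also have "\<dots> = 1 / (central_prob (Suc n) ^ 2 * (2*real n+3))"
    unfolding central_prob_Suc by (rule alg[OF central_prob_pos]) simp
  finally show ?case by simp
qed

text \<open>
  The sequence \<open>b\<close> decreases, and it increases after subtraction of \<open>1 / (48 n^2)\<close>. Wallis' product shows
  that both sequences tend to \<open>0\<close>.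
\<close>
lemma ln_central_prob_bounds:
  assumes "n \<ge> 1"
  defines "b \<equiv> \<lambda>n. ln (central_prob n) + ln (pi * real n) / 2 + 1 / (8 * real n)"
  shows "0 \<le> b n" "b n \<le> 1 / (48 * real n ^ 2)"
proof -
  have step: "b (Suc k) \<le> b k" "b (Suc k) - 1/(48 * real (Suc k)^2) \<ge> b k - 1/(48 * real k ^ 2)"
    if "k \<ge> 1" for k
  proof -
    have k: "real k \<ge> 1" using that by simp
    have 1: "ln (central_prob (Suc k)) = ln (central_prob k) + (ln (2*real k+1) - ln (2*real k+2))"
      using central_prob_pos[of k] k unfolding central_prob_Suc by (simp add: ln_mult ln_div)
    have 2: "ln (pi * real (Suc k)) = ln pi + ln (real k + 1)" "ln (pi * real k) = ln pi + ln (real k)"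
      using k by (simp_all add: ln_mult add.commute)
    have "b (Suc k) - b k = ln (2*real k+1) - ln (2*real k+2) + (ln (real k+1) - ln (real k))/2 
        + 1/(8*(real k+1)) - 1/(8*real k)"
      unfolding b_def 1 2 by (simp add: diff_divide_distrib add_divide_distrib add.commute)
    with ln_central_step[OF k] show "b (Suc k) \<le> b k" 
       "b (Suc k) - 1/(48 * real (Suc k)^2) \<ge> b k - 1/(48 * real k ^ 2)"
      by (simp_all add: add.commute diff_divide_distrib)
  qed
  have lim: "b \<longlonglongrightarrow> 0"
  proof -
    have "(\<lambda>n. 1 / (central_prob n ^ 2 * (2 * real n + 1))) \<longlonglongrightarrow> pi / 2"
      using wallis unfolding central_prob_wallis .
    hence "(\<lambda>n. ln (1 / (central_prob n ^ 2 * (2 * real n + 1)))) \<longlonglongrightarrow> ln (pi/2)"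
      by (rule tendsto_ln) simp
    also have "(\<lambda>n. ln (1 / (central_prob n ^ 2 * (2 * real n + 1)))) 
       = (\<lambda>n. - (2 * ln (central_prob n) + ln (2 * real n + 1)))"
    proof
      fix n show "ln (1 / (central_prob n ^ 2 * (2 * real n + 1))) 
       = - (2 * ln (central_prob n) + ln (2 * real n + 1))"
        using central_prob_pos[of n] by (simp add: ln_div ln_mult ln_realpow)
    qed
    finally have 1: "(\<lambda>n. - (2 * ln (central_prob n) + ln (2 * real n + 1))) \<longlonglongrightarrow> ln (pi/2)" .
    have 2: "(\<lambda>n. (ln (real n) - ln (2*real n+1))/2 + 1 / (8 * real n)) \<longlonglongrightarrow> - (ln 2 / 2)"
      by real_asymp
    have 3: "(\<lambda>n. - (2 * ln (central_prob n) + ln (2 * real n + 1)) * (- 1/2) + 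
        ((ln (real n) - ln (2*real n+1))/2 + 1 / (8 * real n)) + ln pi / 2) \<longlonglongrightarrow>
        ln (pi/2) * (-1/2) + - (ln 2 / 2) + ln pi/2"
      by (intro tendsto_add tendsto_mult tendsto_const 1 2)
    have 4: "ln (pi/2) * (-1/2) + - (ln 2 / 2) + ln pi/2 = 0" by (simp add: ln_div field_simps)
    have "\<forall>\<^sub>F n in sequentially. - (2 * ln (central_prob n) + ln (2 * real n + 1)) * (- 1/2) + 
        ((ln (real n) - ln (2*real n+1))/2 + 1 / (8 * real n)) + ln pi / 2 = b n"
      by (rule eventually_mono[OF eventually_gt_at_top[of 0]]) 
         (simp add: ln_mult ln_div b_def diff_divide_distrib add_divide_distrib)
    from Lim_transform_eventually[OF 3[unfolded 4] this] show ?thesis .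
  qed
  have dec: "decseq (\<lambda>k. b (Suc k))" by (rule decseq_SucI) (use step in auto)
  have "(\<lambda>k. b (Suc k)) \<longlonglongrightarrow> 0" using lim by (rule LIMSEQ_Suc)
  from decseq_ge[OF dec this, of "n-1"] assms show "0 \<le> b n" by simp
  have inc: "incseq (\<lambda>k. b (Suc k) - 1/(48 * real (Suc k)^2))" 
    by (rule incseq_SucI) (use step(2)[of "Suc _"] in simp)
  have "(\<lambda>k. 1/(48 * real (Suc k)^2)) \<longlonglongrightarrow> 0" by real_asymp
  from tendsto_diff[OF LIMSEQ_Suc[OF lim] this]
  have "(\<lambda>k. b (Suc k) - 1/(48 * real (Suc k)^2)) \<longlonglongrightarrow> 0" by simp
  from incseq_le[OF inc this, of "n-1"] assms show "b n \<le> 1 / (48 * real n ^ 2)" by simp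
qed

section \<open>Binomial masses away from the centre\<close>

text \<open>
  Up to sign the left-hand side is the remainder of \<open>2 * artanh x\<close> after its first two terms; its derivative
  is \<open>- 2 x^4 / (1 - x^2)\<close>.
\<close>
lemma ln_ratio_bound:
  fixes x :: real assumes "0 \<le> x" "x \<le> 2/5"
  shows "\<bar>ln (1-x) - ln (1+x) + 2*x + 2*x^3/3\<bar> \<le> x^5/2"
proof -
  define f where "f = (\<lambda>x::real. ln (1-x) - ln (1+x) + 2*x + 2*x^3/3)"
  have d: "(f has_real_derivative - (2*y^4/(1-y^2))) (at y)" if "0 \<le> y" "y \<le> x" for y
  proof -
    have y: "1 - y > 0" "1 + y > 0" using that assms by auto
    have "(f has_real_derivative - (1/(1-y)) - 1/(1+y) + 2 + 2*y^2) (at y)"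
      unfolding f_def using y by (auto intro!: derivative_eq_intros simp: divide_simps)
    also have "- (1/(1-y)) - 1/(1+y) + 2 + 2*y^2 = - (2*y^4/(1-y^2))"
    proof -
      have "1 - y^2 = (1-y)*(1+y)" by (simp add: power2_eq_square algebra_simps)
      thus ?thesis using y by (simp add: divide_simps) (simp add: algebra_simps eval_nat_numeral)
    qed
    finally show ?thesis .
  qed
  have q: "0 \<le> 2*y^4/(1-y^2)" "2*y^4/(1-y^2) \<le> 5/2*y^4" if "0 \<le> y" "y \<le> x" for y
  proof -
    have "y^2 \<le> (2/5)^2" by (rule power_mono) (use that assms in auto)
    hence *: "1 - y^2 \<ge> 4/5" by (simp add: power2_eq_square)
    thus "0 \<le> 2*y^4/(1-y^2)" by simp
    have "2*y^4/(1-y^2) \<le> 2*y^4/(4/5)" using * by (intro divide_left_mono) auto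
    thus "2*y^4/(1-y^2) \<le> 5/2*y^4" by simp
  qed
  have "f x \<le> f 0"
    using assms(1) by (rule DERIV_nonpos_imp_nonincreasing) (use d q in fastforce)
  moreover have "f 0 + 0^5/2 \<le> f x + x^5/2"
    using assms(1)
  proof (rule DERIV_nonneg_imp_nondecreasing[where f="\<lambda>x. f x + x^5/2"])
    fix y assume y: "0 \<le> y" "y \<le> x"
    have "((\<lambda>x::real. x^5/2) has_real_derivative 5/2*y^4) (at y)"
      by (auto intro!: derivative_eq_intros)
    from DERIV_add[OF d[OF y] this] q[OF y]
    show "\<exists>z. ((\<lambda>x. f x + x^5/2) has_real_derivative z) (at y) \<and> 0 \<le> z" by fastforce
  qed
  ultimately show ?thesis unfolding f_def by simp
qed

definition sym_binom :: "nat \<Rightarrow> nat \<Rightarrow> real" where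
  "sym_binom m j = real (m choose j) / 2^m"

lemma sym_binom_pos: "j \<le> m \<Longrightarrow> sym_binom m j > 0"
  by (simp add: sym_binom_def)

lemma sym_binom_ratio:
  assumes "j < m"
  shows "sym_binom m (Suc j) = sym_binom m j * ((real m - real j) / (real j + 1))"
proof -
  have "real (Suc j) * real (m choose Suc j) = real (m choose j) * real (m - j)"
    using binomial_absorb_comp[of m j] binomial_absorption[of j m] by (metis mult.commute of_nat_mult)
  thus ?thesis using assms unfolding sym_binom_def
    by (simp add: divide_simps of_nat_diff) (simp add: algebra_simps)
qed

text \<open>
  The approximate logarithm of the mass at distance \<open>t\<close> from \<open>m / 2\<close>. The coefficients of \<open>t^2\<close> and \<open>t^4\<close>
  make its increments reproduce the first two terms of \<open>- 2 * artanh (s / N)\<close>, up to \<open>s / (6 N^3)\<close>, and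
  the constant is the one that the central mass forces, up to order \<open>1 / N^2\<close>, for either parity of \<open>m\<close>.
\<close>
definition log_profile :: "real \<Rightarrow> real \<Rightarrow> real" where
  "log_profile N t = - ln (pi * N) / 2 + 1 / (8*N) - t^2 / N - t^4 / (6*N^3)"

lemma log_profile_step:
  assumes "N > 0"
  shows "log_profile N (s + 1/2) - log_profile N (s - 1/2) = - (2*(s/N)) - 2*(s/N)^3/3 - s / (6*N^3)"
  using assms unfolding log_profile_def by (simp add: divide_simps) algebra

text \<open>
  For \<open>m = 2 n\<close> the first lattice point from \<open>m / 2\<close> on is the centre itself; for \<open>m = 2 n - 1\<close> it is \<open>n\<close>,
  at distance \<open>1/2\<close>. Its mass is \<open>central_prob n\<close> in both cases, and the different values of \<open>N\<close> and \<open>t\<close> are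
  absorbed by \<open>log_profile\<close>.
\<close>
lemma ln_sym_binom_centre:
  assumes "m \<ge> 1"
  defines "j \<equiv> (m+1) div 2" and "N \<equiv> (real m + 1)/2"
  shows "\<bar>ln (sym_binom m j) - log_profile N (real j - real m / 2)\<bar> \<le> 1 / N^2"
proof (cases "even m")
  case True
  then obtain n where n: "m = 2*n" by auto
  hence n1: "n \<ge> 1" using assms by simp
  have j: "j = n" and N: "N = real n + 1/2" unfolding j_def N_def n by simp_all
  define b where "b = ln (central_prob n) + ln (pi * real n) / 2 + 1 / (8 * real n)"
  have b: "0 \<le> b" "b \<le> 1/(48 * real n ^ 2)" using ln_central_prob_bounds[OF n1] unfolding b_def by auto
  have s: "sym_binom m j = central_prob n" unfolding sym_binom_def central_prob_def n j 
    by (simp add: power_mult)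
  define x where "x = real n"
  have x: "x \<ge> 1" using n1 x_def by simp
  have lN: "ln (pi * N) = ln (pi * x) + ln (1 + 1/(2*x))"
  proof -
    have "pi * N = (pi * x) * (1 + 1/(2*x))" using x unfolding N x_def[symmetric] by (simp add: field_simps)
    moreover have "1 + 1/(2*x) > 0" using x by (simp add: add_pos_pos)
    ultimately show ?thesis using x by (simp add: ln_mult del: zero_less_divide_iff)
  qed
  have l: "ln (1 + 1/(2*x)) \<le> 1/(2*x)" "ln (1 + 1/(2*x)) \<ge> 1/(2*x) - (1/(2*x))^2"
    using x ln_add_one_self_le_self[of "1/(2*x)"] ln_one_plus_pos_lower_bound[of "1/(2*x)"] by auto
  have eq: "ln (sym_binom m j) - log_profile N (real j - real m / 2) = 
    b - 1/(8*x) - 1/(8*N) + ln (1 + 1/(2*x)) / 2"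
    unfolding s log_profile_def lN b_def using x by (simp add: n j x_def field_simps)
  have i1: "1/(8*N) \<le> 1/(8*x)" using x unfolding N x_def[symmetric] by (simp add: divide_simps)
  have i2: "1/(8*N) \<ge> 1/(8*x) - 1/(16*x^2)" 
  proof -
    have "1/(8*N) - (1/(8*x) - 1/(16*x^2)) = 1/(16*x^2*(2*x+1))"
      using x unfolding N x_def[symmetric] by (simp add: divide_simps) algebra
    moreover have "\<dots> \<ge> 0" using x by simp
    ultimately show ?thesis by linarith
  qed
  have i3: "(1/(2*x))^2 = 1/(4*x^2)" by (simp add: power2_eq_square)
  have i4: "1 / x^2 \<le> 4 * (1/N^2)"
  proof -
    have "N \<le> 2*x" using x unfolding N x_def[symmetric] by simp
    hence "N^2 \<le> (2*x)^2" using x unfolding N x_def[symmetric] by (intro power_mono) auto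
    thus ?thesis using x unfolding N x_def[symmetric] by (simp add: divide_simps power_mult_distrib)
  qed
  have i5: "1/(4*x^2) = (1/x^2)/4" "1/(16*x^2) = (1/x^2)/16" "1/(48*x^2) = (1/x^2)/48" by simp_all
  have i6: "1/(2*x) = 4*(1/(8*x))" by simp
  show ?thesis unfolding eq abs_le_iff
    using b(1) b(2)[folded x_def, unfolded i5] l[unfolded i3 i6 i5] i1 i2[unfolded i5] i4 zero_le_power2[of "1/x"]
    by (simp add: power_divide)
next
  case False
  then obtain k where "m = 2*k+1" by (auto elim: oddE)
  then obtain n where n: "m = 2*n-1" "n \<ge> 1" by (intro that[of "Suc k"]) auto
  have j: "j = n" and N: "N = real n" unfolding j_def N_def using n by (auto simp: of_nat_diff)
  define b where "b = ln (central_prob n) + ln (pi * real n) / 2 + 1 / (8 * real n)"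
  have b: "0 \<le> b" "b \<le> 1/(48 * real n ^ 2)" using ln_central_prob_bounds[OF n(2)] unfolding b_def by auto
  have s: "sym_binom m j = central_prob n"
  proof -
    obtain q where q: "n = Suc q" using n(2) by (metis Suc_le_D One_nat_def)
    have "(2*n) choose n = 2 * ((2*n-1) choose n)"
      using binomial_symmetric[of q "Suc (2*q)"] unfolding q by simp
    moreover have "(4::real)^n = 2 * 2^(2*n-1)" unfolding q by (simp add: power_mult)
    ultimately show ?thesis unfolding sym_binom_def central_prob_def j n(1) by simp
  qed
  have t: "real j - real m / 2 = 1/2" using n j by (simp add: of_nat_diff field_simps)
  define x where "x = real n"
  have x: "x \<ge> 1" using n(2) x_def by simp
  have eq: "ln (sym_binom m j) - log_profile N (real j - real m / 2) = b + 1/(96*x^3)"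
    unfolding s log_profile_def t b_def N x_def[symmetric] using x by (simp add: field_simps power_divide)
  have "1/(96*x^3) \<le> 1/(96*x^2)" using x by (intro divide_left_mono mult_left_mono power_increasing) auto
  moreover have "1/(96*x^2) = (1/x^2)/96" "1/(48*x^2) = (1/x^2)/48" by simp_all
  moreover have "1/(96*x^3) \<ge> 0" "1/x^2 \<ge> 0" using x by auto
  ultimately show ?thesis unfolding eq using b by (simp add: N x_def[symmetric])
qed

text \<open>
  Induction outwards from the centre. With \<open>x = s / N\<close>, one step adds an error of at most
  \<open>x^5 / 2 + s / (6 N^3)\<close>, and the two polynomials in \<open>t\<close> have increments that dominate these terms.
\<close>
lemma ln_sym_binom_bound:
  assumes "m \<ge> 1" "(m+1) div 2 \<le> j"
  defines "N \<equiv> (real m + 1)/2"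
  assumes "real j - real m / 2 \<le> 2/5 * N"
  defines "t \<equiv> real j - real m / 2"
  shows "\<bar>ln (sym_binom m j) - log_profile N t\<bar> \<le> 1 / N^2 + t^2/(12*N^3) + t^6/(12*N^5)"
  using assms(2,4) unfolding t_def
proof (induction j rule: dec_induct)
  case base
  have "N > 0" unfolding N_def by simp
  hence "0 \<le> (real ((m + 1) div 2) - real m / 2)\<^sup>2 / (12 * N ^ 3)"
    "0 \<le> (real ((m + 1) div 2) - real m / 2)^6 / (12 * N ^ 5)" by simp_all
  with ln_sym_binom_centre[OF assms(1), folded N_def] show ?case by linarith
next
  case (step j)
  have N: "N \<ge> 1" unfolding N_def using assms(1) by simp
  define s where "s = real j - real m / 2 + 1/2"
  have sN: "N - s = real m - real j" "N + s = real j + 1" unfolding N_def s_def by (simp_all add: field_simps)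
  have s: "s \<ge> 0" unfolding s_def using step(1) by linarith
  have s2: "s \<le> 2/5*N" using step(4) unfolding s_def by simp
  hence "N - s > 0" using N by simp
  hence jm: "j < m" unfolding sN by simp
  define x where "x = s/N"
  have x: "0 \<le> x" "x \<le> 2/5" unfolding x_def using s s2 N by (simp_all add: divide_simps)
  have "ln (sym_binom m (Suc j)) = ln (sym_binom m j) + (ln (N-s) - ln (N+s))"
    unfolding sym_binom_ratio[OF jm] sN using jm sym_binom_pos[of j m] by (simp add: ln_mult ln_div)
  also have "ln (N-s) - ln (N+s) = ln (1-x) - ln (1+x)"
  proof -
    have "N - s = N*(1-x)" "N + s = N*(1+x)" unfolding x_def using N by (simp_all add: field_simps)
    thus ?thesis using x N by (simp add: ln_mult)
  qed
  finally have 1: "ln (sym_binom m (Suc j)) = ln (sym_binom m j) + (ln (1-x) - ln (1+x))" .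
  have ts: "real (Suc j) - real m / 2 = s + 1/2" "real j - real m / 2 = s - 1/2" unfolding s_def by simp_all
  have 2: "log_profile N (s+1/2) = log_profile N (s-1/2) - 2*x - 2*x^3/3 - s/(6*N^3)"
    using log_profile_step[of N s] N unfolding x_def by simp
  have IH: "\<bar>ln (sym_binom m j) - log_profile N (s-1/2)\<bar> \<le> 1/N^2 + (s-1/2)^2/(12*N^3) + (s-1/2)^6/(12*N^5)"
    using step(3) step(4) unfolding ts by simp
  have 3: "\<bar>ln (1-x) - ln (1+x) + 2*x + 2*x^3/3\<bar> \<le> x^5/2" by (rule ln_ratio_bound[OF x])
  have 4: "(s+1/2)^2/(12*N^3) = (s-1/2)^2/(12*N^3) + s/(6*N^3)"
    using N by (simp add: divide_simps) algebra
  have "(s+1/2)^6 = (s-1/2)^6 + 6 * s^5 + (5 * s^3 + 3/8 * s)" by algebra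
  hence "(s+1/2)^6 \<ge> (s-1/2)^6 + 6 * s^5" using s by simp
  hence "(s+1/2)^6/(12*N^5) \<ge> ((s-1/2)^6 + 6 * s^5)/(12*N^5)"
    using N by (intro divide_right_mono) auto
  also have "((s-1/2)^6 + 6 * s^5)/(12*N^5) = (s-1/2)^6/(12*N^5) + x^5/2"
    unfolding x_def using N by (simp add: field_simps)
  finally have 5: "(s+1/2)^6/(12*N^5) \<ge> (s-1/2)^6/(12*N^5) + x^5/2" .
  have 6: "s/(6*N^3) \<ge> 0" using s N by simp
  show ?case unfolding ts 1 2 using IH 3 4 5 6 by linarith
qed

lemma exp_quadratic_upper:
  fixes x :: real assumes "x \<le> 1" shows "exp x \<le> 1 + x + x^2"
proof (cases "x \<ge> 0")
  case True thus ?thesis using exp_bound[of x] assms by simp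
next
  case False
  define y where "y = -x"
  have y: "y > 0" using False y_def by simp
  have "exp y \<ge> 1 + y + y^2/2" using exp_lower_Taylor_quadratic[of y] y by simp
  moreover have D: "1 + y + y^2/2 > 0" using y by (intro add_pos_pos) auto
  ultimately have "exp (-y) \<le> 1/(1 + y + y^2/2)"
    unfolding exp_minus inverse_eq_divide by (intro divide_left_mono mult_pos_pos) auto
  also have "\<dots> \<le> 1 - y + y^2"
  proof -
    have "(1 - y + y^2) * (1 + y + y^2/2) = 1 + y^2/2 + y^3/2 + y^4/2"
      by (simp add: field_simps eval_nat_numeral)
    also have "\<dots> \<ge> 1" using y by simp
    finally show ?thesis unfolding pos_divide_le_eq[OF D] .
  qed
  finally show ?thesis unfolding y_def by simp
qed

lemma power_le_one_plus_power:
  fixes w :: real assumes "0 \<le> w" "k \<le> n" shows "w^k \<le> 1 + w^n"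
proof (cases "w \<le> 1")
  case True
  have "w^k \<le> 1" by (rule power_le_one) (use True assms in auto)
  moreover have "0 \<le> w^n" using assms by simp
  ultimately show ?thesis by linarith
next
  case False
  have "w^k \<le> w^n" by (rule power_increasing) (use False assms in auto)
  thus ?thesis by linarith
qed

text \<open>
  In terms of \<open>v\<close> the profile is \<open>ln (\<phi> v * sqrt (2 / N)) + (3 - v^4) / (24 N)\<close>. The condition \<open>v^4 \<le> N\<close> bounds
  the last term and the error of the profile, so that the exponential can be linearised.
\<close>
lemma sym_binom_approx:
  assumes "m \<ge> 1" "(m+1) div 2 \<le> j"
  defines "N \<equiv> (real m + 1)/2"
  defines "v \<equiv> (real j - real m / 2) * sqrt (2/N)"
  assumes "N \<ge> 100" "v^4 \<le> N"
  shows "\<bar>sym_binom m j - sqrt (2/N) * (std_normal_density v * (1 + (3 - v^4)/(24*N)))\<bar>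
      \<le> sqrt (2/N) * (std_normal_density v * (5 * (1 + v^8) / N^2))"
proof -
  define t where "t = real j - real m / 2"
  have N: "N \<ge> 100" by fact
  have t0: "t \<ge> 0" unfolding t_def using assms(2) by linarith
  have vt: "v = t * sqrt (2/N)" unfolding v_def t_def ..
  have v0: "v \<ge> 0" unfolding vt using t0 N by simp
  have v2: "v^2 = 2*t^2/N" unfolding vt using N by (simp add: power_mult_distrib)
  have v4: "v^4 = 4*t^4/N^2"
  proof -
    have "v^4 = (v^2)^2" by simp
    thus ?thesis unfolding v2 by (simp add: power_divide power_mult_distrib)
  qed
  have v6: "v^6 = 8*t^6/N^3"
  proof -
    have "v^6 = (v^2)^3" by simp
    thus ?thesis unfolding v2 by (simp add: power_divide power_mult_distrib)
  qed
  have v2N: "v^2 \<le> 1 + N"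
  proof -
    have "(v^2)^2 \<le> N" using assms(6) by simp
    moreover have "0 \<le> (v^2 - 1)^2" by simp
    hence "2 * v^2 \<le> 1 + (v^2)^2" by (simp add: power2_eq_square algebra_simps)
    ultimately show ?thesis using zero_le_power2[of v] by linarith
  qed
  \<comment> \<open>\<open>v^4 \<le> N\<close> says \<open>4 t^4 \<le> N^3\<close>, which forces \<open>t / N\<close> to be small.\<close>
  have tN: "t \<le> 2/5*N"
  proof (rule ccontr)
    assume "\<not> t \<le> 2/5*N"
    hence "t^4 > (2/5*N)^4" using N by (intro power_strict_mono) auto
    hence "t^4 > 16/625 * N^4" by (simp add: power_mult_distrib power_divide)
    moreover have "4*t^4 \<le> N^3" using assms(6) N unfolding v4 
      by (simp add: divide_simps power2_eq_square power3_eq_cube)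
    ultimately have "64/625 * N^4 < N^3" by simp
    hence "N^3 * (64/625*N) < N^3 * 1" by (simp add: power3_eq_cube power4_eq_xxxx algebra_simps)
    hence "64/625*N < 1" using N by (subst (asm) mult_less_cancel_left_pos) auto
    thus False using N by simp
  qed
  define E where "E = ln (sym_binom m j) - log_profile N t"
  have "\<bar>E\<bar> \<le> 1 / N^2 + t^2/(12*N^3) + t^6/(12*N^5)"
    unfolding E_def t_def N_def
    by (rule ln_sym_binom_bound[OF assms(1,2)]) (use tN in \<open>simp add: t_def N_def\<close>)
  also have "\<dots> = (1 + v^2/24 + v^6/96)/N^2" unfolding v2 v6 using N by (simp add: field_simps) (simp add: eval_nat_numeral)
  finally have E: "\<bar>E\<bar> \<le> (1 + v^2/24 + v^6/96)/N^2" .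
  define w where "w = v^2"
  have w: "w \<ge> 0" "w^2 \<le> N" "w \<le> 1 + N" "w^4 = v^8" "w^3 = v^6" "w^2 = v^4" 
    unfolding w_def using assms(6) v2N by simp_all
  have v8: "0 \<le> v^8" by simp
  have pw: "w \<le> 1 + w^4" "w^3 \<le> 1 + w^4"
    using power_le_one_plus_power[OF w(1), of 1 4] power_le_one_plus_power[OF w(1), of 3 4] by auto
  have E2: "\<bar>E\<bar> \<le> 2*(1 + v^8)/N^2"
  proof -
    have "1 + v^2/24 + v^6/96 \<le> 2*(1+v^8)" using pw v8 unfolding w(4,5) unfolding w_def by argo
    hence "(1 + v^2/24 + v^6/96)/N^2 \<le> 2*(1 + v^8)/N^2" by (intro divide_right_mono) auto
    with E show ?thesis by simp
  qed
  have E1: "\<bar>E\<bar> \<le> 1/2"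
  proof -
    have "w^3 = w * w^2" by (simp add: power3_eq_cube power2_eq_square)
    also have "\<dots> \<le> (1+N) * N" using w N by (intro mult_mono) auto
    finally have w3: "v^6 \<le> (1+N)*N" using w by simp
    have "1 + v^2/24 + v^6/96 \<le> 1 + (1+N)/24 + (1+N)*N/96" using w3 v2N
      by (intro add_mono divide_right_mono) auto
    also have "\<dots> \<le> N^2/2"
    proof -
      define q where "q = N^2"
      have "N * 100 \<le> N * N" using N by (intro mult_left_mono) auto
      hence "q \<ge> 100 * N" "(1+N)*N = N + q" unfolding q_def by (simp_all add: power2_eq_square algebra_simps)
      moreover have "1 + (1+N)/24 + (N+q)/96 \<le> q/2" if "q \<ge> 100 * N"
        using N that by argo
      ultimately show ?thesis unfolding q_def[symmetric] by simp
    qed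
    finally have "(1 + v^2/24 + v^6/96)/N^2 \<le> 1/2" using N by (simp add: divide_simps)
    with E show ?thesis by (rule order_trans)
  qed
  define y where "y = (3 - v^4)/(24*N)"
  have y: "\<bar>y\<bar> \<le> 1/2" 
  proof -
    have v4p: "0 \<le> v^4" by simp
    have "\<bar>3 - v^4\<bar> \<le> 3 + N" using assms(6) N v4p unfolding abs_le_iff by linarith
    also have "\<dots> \<le> 12 * N" using N by simp
    finally show ?thesis unfolding y_def using N by (simp add: abs_divide divide_simps)
  qed
  have y2: "y^2 \<le> (1+v^8)/ (8*N^2)"
  proof -
    have aux: "9 - 6*W + V \<le> 72*(1+V)" if "0 \<le> V" "0 \<le> W" for V W :: real
      using that by argo
    have "(3 - v^4)^2 = 9 - 6*w^2 + v^8" using w(4)[symmetric] w(6)[symmetric] by (simp add: power2_eq_square power4_eq_xxxx algebra_simps)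
    also have "\<dots> \<le> 72*(1+v^8)" using aux[OF v8 zero_le_power[OF w(1), of 2]] .
    finally have "(3-v^4)^2/(24*N)^2 \<le> 72*(1+v^8)/(24*N)^2" by (intro divide_right_mono) auto
    also have "72*(1+v^8)/(24*N)^2 = (1+v^8)/(8*N^2)" using N by (simp add: power_mult_distrib field_simps)
    finally show ?thesis unfolding y_def by (simp only: power_divide)
  qed
  have "sym_binom m j > 0"
  proof -
    have "real j \<le> real m" using tN t_def N_def assms(5) by simp
    thus ?thesis using sym_binom_pos[of j m] by simp
  qed
  hence "sym_binom m j = exp (log_profile N t + E)" unfolding E_def by simp
  also have "\<dots> = exp (- ln (pi*N)/2) * exp (- (v^2/2)) * exp (y + E)"
  proof -
    have "log_profile N t + E = - ln (pi*N)/2 + - (v^2/2) + (y+E)"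
      unfolding log_profile_def y_def v2 v4 using N
      by (simp add: field_simps) (simp add: eval_nat_numeral)
    thus ?thesis by (simp only: exp_add)
  qed
  also have "exp (- ln (pi*N)/2) = sqrt (2/N) * (1/sqrt (2*pi))"
  proof -
    have "exp (- ln (pi*N)/2) = 1 / exp (ln (pi*N)/2)" by (simp add: exp_minus inverse_eq_divide)
    also have "exp (ln (pi*N)/2) = sqrt (pi*N)"
      using N by (subst ln_sqrt[symmetric]) auto
    finally show ?thesis using N by (simp add: real_sqrt_mult real_sqrt_divide)
  qed
  finally have h: "sym_binom m j = sqrt (2/N) * (std_normal_density v * exp (y+E))"
    by (simp add: std_normal_density_def)
  have "exp (y+E) \<le> 1 + (y+E) + (y+E)^2" by (rule exp_quadratic_upper) (use y E1 in linarith)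
  moreover have "exp (y+E) \<ge> 1 + (y+E)" by simp
  moreover have "(y+E)^2 \<le> 2*y^2 + 2*E^2" using zero_le_power2[of "y-E"] by (simp add: power2_eq_square algebra_simps)
  moreover have "2*E^2 \<le> \<bar>E\<bar>"
  proof -
    have "E^2 = \<bar>E\<bar> * \<bar>E\<bar>" by (simp add: power2_eq_square)
    also have "\<dots> \<le> \<bar>E\<bar> * (1/2)" using E1 by (intro mult_left_mono) auto
    finally show ?thesis by simp
  qed
  ultimately have "\<bar>exp (y+E) - (1+y)\<bar> \<le> 2*\<bar>E\<bar> + 2*y^2" by linarith
  also have "\<dots> \<le> 5*(1+v^8)/N^2"
  proof -
    define K where "K = (1+v^8)/N^2"
    have K: "K \<ge> 0" unfolding K_def using v8 by simp
    have "2*(1 + v^8)/N^2 = 2*K" "5*(1+v^8)/N^2 = 5*K" "(1+v^8)/ (8*N^2) = K/8" unfolding K_def by simp_all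
    thus ?thesis using E2 y2 K by linarith
  qed
  finally have fin: "\<bar>exp (y+E) - (1+y)\<bar> \<le> 5*(1+v^8)/N^2" .
  have "sym_binom m j - sqrt (2/N) * (std_normal_density v * (1 + y))
      = sqrt (2/N) * (std_normal_density v * (exp (y+E) - (1+y)))" unfolding h by (simp add: algebra_simps)
  hence "\<bar>sym_binom m j - sqrt (2/N) * (std_normal_density v * (1 + y))\<bar> 
      = sqrt (2/N) * (std_normal_density v * \<bar>exp (y+E) - (1+y)\<bar>)"
    using N by (simp add: abs_mult)
  also have "\<dots> \<le> sqrt (2/N) * (std_normal_density v * (5*(1+v^8)/N^2))"
    using N fin by (intro mult_left_mono) auto
  finally show ?thesis unfolding y_def by simp
qed

section \<open>The standard normal distribution function\<close>

lemma exp_minus_le_power: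
  fixes y :: real assumes "y \<ge> 0" shows "y^n * exp (-y) \<le> fact n"
proof -
  have "y^n / fact n \<le> exp y"
  proof -
    have "sum (\<lambda>k. y^k /\<^sub>R fact k) {n} \<le> (\<Sum>k. y^k /\<^sub>R fact k)"
      by (rule sum_le_suminf) (use assms summable_exp_generic[of y] in auto)
    thus ?thesis by (simp add: exp_def divide_inverse mult.commute)
  qed
  hence "y^n \<le> fact n * exp y" by (simp add: pos_divide_le_eq mult.commute)
  hence "y^n * exp (-y) \<le> fact n * exp y * exp (-y)" by (intro mult_right_mono) auto
  thus ?thesis by (simp add: exp_minus mult.assoc)
qed

lemma std_normal_even_moment_bound:
  "v^(2*n) * std_normal_density v \<le> fact n * 2^n / 2"
proof -
  have "(v^2/2)^n * exp (-(v^2/2)) \<le> fact n" by (rule exp_minus_le_power) simp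
  hence "v^(2*n) * exp (-(v^2/2)) \<le> fact n * 2^n"
    by (simp add: power_divide power_mult pos_divide_le_eq)
  hence "v^(2*n) * exp (-(v^2/2)) / sqrt (2*pi) \<le> fact n * 2^n / sqrt (2*pi)"
    by (intro divide_right_mono) auto
  also have "\<dots> \<le> fact n * 2^n / 2"
  proof (intro divide_left_mono)
    have "sqrt (2^2) \<le> sqrt (2*pi)" using pi_ge_two by (intro real_sqrt_le_mono) simp
    thus "2 \<le> sqrt (2*pi)" by simp
  qed auto
  finally show ?thesis by (simp add: std_normal_density_def mult.commute)
qed

text \<open>Crude constants suffice, because errors of size \<open>20^6\<close> are admitted in the end.\<close>
lemma std_normal_weight_bounds:
  "(1 + v^2) * ((1 + v^8) * std_normal_density v) \<le> 3000"
  "std_normal_density v \<le> 1/2" "v^2 * std_normal_density v \<le> 1" "v^4 * std_normal_density v \<le> 4"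
  "v^6 * std_normal_density v \<le> 24" "v^8 * std_normal_density v \<le> 192" "v^10 * std_normal_density v \<le> 1920"
proof -
  show b: "std_normal_density v \<le> 1/2" "v^2 * std_normal_density v \<le> 1" "v^4 * std_normal_density v \<le> 4"
  "v^6 * std_normal_density v \<le> 24" "v^8 * std_normal_density v \<le> 192" "v^10 * std_normal_density v \<le> 1920"
    using std_normal_even_moment_bound[of v 0] std_normal_even_moment_bound[of v 1] 
      std_normal_even_moment_bound[of v 2] std_normal_even_moment_bound[of v 3]
      std_normal_even_moment_bound[of v 4] std_normal_even_moment_bound[of v 5]
    by (simp_all add: fact_numeral)
  have "(1 + v^2) * ((1 + v^8) * std_normal_density v) = std_normal_density v + v^2 * std_normal_density v
     + v^8 * std_normal_density v + v^10 * std_normal_density v"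
    by (simp add: algebra_simps power_add[symmetric])
  thus "(1 + v^2) * ((1 + v^8) * std_normal_density v) \<le> 3000" using b by simp
qed

lemma DERIV_std_normal_density:
  "(std_normal_density has_real_derivative - v * std_normal_density v) (at v)"
proof -
  have "((\<lambda>v. exp (- v\<^sup>2 / 2)) has_real_derivative - v * exp (- v\<^sup>2 / 2)) (at v)"
    by (auto intro!: derivative_eq_intros)
  from DERIV_cmult[OF this, of "1 / sqrt (2 * pi)"] show ?thesis
    unfolding std_normal_density_def by (simp add: mult.left_commute)
qed

lemma DERIV_poly_std_normal:
  assumes "(p has_real_derivative p') (at v)"
  shows "((\<lambda>v. p v * std_normal_density v) has_real_derivative (p' - v * p v) * std_normal_density v) (at v)"
  using DERIV_mult[OF assms DERIV_std_normal_density] by (simp add: algebra_simps)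

definition std_normal_cdf :: "real \<Rightarrow> real" where
  "std_normal_cdf = cdf (density lborel std_normal_density)"

interpretation std_normal: prob_space "density lborel std_normal_density"
  by (rule prob_space_normal_density) simp

interpretation std_normal: real_distribution "density lborel std_normal_density"
  by unfold_locales auto

lemma std_normal_cdf_diff:
  assumes "a \<le> b"
  shows "std_normal_cdf b - std_normal_cdf a = integral {a..b} std_normal_density"
proof (cases "a = b")
  case False
  let ?D = "density lborel std_normal_density"
  have "std_normal_cdf b - std_normal_cdf a = measure ?D {a<..b}"
    unfolding std_normal_cdf_def using std_normal.cdf_diff_eq[of a b] False assms by simp
  also have "\<dots> = enn2real (\<integral>\<^sup>+x. ennreal (std_normal_density x) * indicator {a<..b} x \<partial>lborel)"
    by (simp add: measure_def emeasure_density)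
  also have "(\<integral>\<^sup>+x. ennreal (std_normal_density x) * indicator {a<..b} x \<partial>lborel)
    = (\<integral>\<^sup>+x. ennreal (std_normal_density x) * indicator {a..b} x \<partial>lborel)"
  proof (rule nn_integral_cong_AE)
    show "AE x in lborel. ennreal (std_normal_density x) * indicator {a<..b} x
        = ennreal (std_normal_density x) * indicator {a..b} x"
      using AE_lborel_singleton[of a] by eventually_elim (auto split: split_indicator)
  qed
  also have "\<dots> = (\<integral>\<^sup>+x. ennreal (indicator {a..b} x * std_normal_density x) \<partial>lborel)"
    by (intro nn_integral_cong) (auto split: split_indicator)
  also have "\<dots> = ennreal (integral\<^sup>L lborel (\<lambda>x. indicator {a..b} x * std_normal_density x))"
    by (rule nn_integral_eq_integral)
       (use integrable_real_mult_indicator[of "{a..b}" lborel std_normal_density] in \<open>auto simp: mult.commute\<close>)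
  also have "integral\<^sup>L lborel (\<lambda>x. indicator {a..b} x * std_normal_density x) = (LINT x:{a..b}|lborel. std_normal_density x)"
    by (simp add: set_lebesgue_integral_def)
  also have "\<dots> = integral {a..b} std_normal_density"
    by (rule set_borel_integral_eq_integral(2))
       (use integrable_real_mult_indicator[of "{a..b}" lborel std_normal_density] in \<open>auto simp: set_integrable_def mult.commute\<close>)
  finally have "std_normal_cdf b - std_normal_cdf a = enn2real (ennreal (integral {a..b} std_normal_density))" .
  moreover have "integral {a..b} std_normal_density \<ge> 0"
    by (intro integral_nonneg integrable_continuous_real continuous_at_imp_continuous_on ballI 
        DERIV_isCont[OF DERIV_std_normal_density] normal_density_nonneg)
  ultimately show ?thesis by simp
qed simp

lemma DERIV_std_normal_cdf: "(std_normal_cdf has_real_derivative std_normal_density v) (at v)"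
proof -
  let ?g = "\<lambda>x. integral {v-1..x} std_normal_density"
  have c: "continuous_on S std_normal_density" for S
    by (intro continuous_at_imp_continuous_on ballI DERIV_isCont[OF DERIV_std_normal_density])
  have "(?g has_real_derivative std_normal_density v) (at v within {v-1..v+1})"
    by (rule integral_has_real_derivative[OF c]) auto
  hence "(?g has_real_derivative std_normal_density v) (at v)"
    by (subst (asm) at_within_interior) auto
  hence "((\<lambda>x. std_normal_cdf (v-1) + ?g x) has_real_derivative std_normal_density v) (at v)"
    by (auto intro!: derivative_eq_intros)
  moreover have "\<forall>\<^sub>F x in nhds v. std_normal_cdf (v-1) + ?g x = std_normal_cdf x"
  proof -
    have "\<forall>\<^sub>F x in nhds v. x > v - 1" by (rule eventually_nhds_in_open[of "{v-1<..}" v, simplified])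
    thus ?thesis
    proof (rule eventually_mono)
      fix x assume "v - 1 < x"
      thus "std_normal_cdf (v-1) + ?g x = std_normal_cdf x" 
        using std_normal_cdf_diff[of "v-1" x] by linarith
    qed
  qed
  ultimately show ?thesis by (subst (asm) DERIV_cong_ev) auto
qed

lemma std_normal_density_minus [simp]: "std_normal_density (- v) = std_normal_density v"
  by (simp add: std_normal_density_def)

text \<open>As the density is even, \<open>\<Phi> x + \<Phi> (- x)\<close> has derivative \<open>0\<close> and so equals its limit at infinity.\<close>
lemma std_normal_cdf_minus: "std_normal_cdf (- v) = 1 - std_normal_cdf v"
proof -
  let ?h = "\<lambda>x. std_normal_cdf x + std_normal_cdf (-x)"
  have d: "(?h has_real_derivative 0) (at x)" for x
  proof -
    have "((\<lambda>x. std_normal_cdf (-x)) has_real_derivative - std_normal_density x) (at x)"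
      using iffD1[OF DERIV_mirror DERIV_std_normal_cdf[of "-x"]] by simp
    from DERIV_add[OF DERIV_std_normal_cdf this] show ?thesis by simp
  qed
  define c where "c = ?h v"
  have const: "?h x = c" for x unfolding c_def by (rule DERIV_isconst_all) (rule allI, rule d)
  have "(?h \<longlongrightarrow> 1 + 0) at_top" unfolding std_normal_cdf_def
    by (intro tendsto_add std_normal.cdf_lim_at_top_prob filterlim_compose[OF std_normal.cdf_lim_at_bot] filterlim_uminus_at_bot_at_top)
  moreover have "(?h \<longlongrightarrow> c) at_top" unfolding const by (rule tendsto_const)
  ultimately have "c = 1 + 0" by (intro tendsto_unique[where F="at_top::real filter"]) auto
  thus ?thesis unfolding c_def by simp
qed

lemma std_normal_cdf_strict_mono: "a < b \<Longrightarrow> std_normal_cdf a < std_normal_cdf b"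
  by (rule DERIV_pos_imp_increasing) (auto intro!: exI conjI DERIV_std_normal_cdf normal_density_pos)

lemma std_normal_cdf_mono: "a \<le> b \<Longrightarrow> std_normal_cdf a \<le> std_normal_cdf b"
  using std_normal_cdf_strict_mono[of a b] by (cases "a = b") auto

section \<open>Increments over lattice cells\<close>

text \<open>
  In this expansion about a midpoint and in the next one the Taylor terms of even order cancel; \<open>g\<close> lists the
  successive derivatives.
\<close>
lemma symmetric_difference_cubic:
  fixes g :: "nat \<Rightarrow> real \<Rightarrow> real"
  assumes d: "\<And>k x. k < 3 \<Longrightarrow> (g k has_real_derivative g (Suc k) x) (at x)" and "\<delta> > 0"
    and b: "\<And>x. \<bar>x - v\<bar> \<le> \<delta> \<Longrightarrow> \<bar>g 3 x\<bar> \<le> B"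
  shows "\<bar>g 0 (v+\<delta>) - g 0 (v-\<delta>) - 2*\<delta>*g 1 v\<bar> \<le> B * \<delta>^3 / 3"
proof -
  have "\<exists>t. v < t \<and> t < v+\<delta> \<and>
     g 0 (v+\<delta>) = (\<Sum>m<3. (g m v / fact m) * (v+\<delta>-v)^m) + (g 3 t / fact 3) * (v+\<delta>-v)^3"
    by (rule Taylor_up[of 3 g "g 0" v]) (simp_all add: assms)
  then obtain t where t: "v < t" "t < v+\<delta>" 
     "g 0 (v+\<delta>) = (\<Sum>m<3. (g m v / fact m) * (v+\<delta>-v)^m) + (g 3 t / fact 3) * (v+\<delta>-v)^3" by blast
  have "\<exists>s. v-\<delta> < s \<and> s < v \<and>
     g 0 (v-\<delta>) = (\<Sum>m<3. (g m v / fact m) * (v-\<delta>-v)^m) + (g 3 s / fact 3) * (v-\<delta>-v)^3"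
    by (rule Taylor_down[of 3 g "g 0" _ v]) (simp_all add: assms)
  then obtain s where s: "v-\<delta> < s" "s < v" 
     "g 0 (v-\<delta>) = (\<Sum>m<3. (g m v / fact m) * (v-\<delta>-v)^m) + (g 3 s / fact 3) * (v-\<delta>-v)^3" by blast
  have dd: "v+\<delta>-v = \<delta>" "v-\<delta>-v = -\<delta>" by simp_all
  have "g 0 (v+\<delta>) - g 0 (v-\<delta>) - 2*\<delta>*g 1 v = (g 3 t + g 3 s) * \<delta>^3 / 6"
    unfolding t(3) s(3) dd by (simp add: eval_nat_numeral) (simp add: algebra_simps)
  hence "\<bar>g 0 (v+\<delta>) - g 0 (v-\<delta>) - 2*\<delta>*g 1 v\<bar> = \<bar>g 3 t + g 3 s\<bar> * (\<delta>^3 / 6)"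
    using \<open>\<delta> > 0\<close> by (simp only: abs_mult abs_divide) simp
  also have "\<bar>g 3 t + g 3 s\<bar> \<le> 2*B" using b[of t] b[of s] t s \<open>\<delta> > 0\<close> by linarith
  hence "\<bar>g 3 t + g 3 s\<bar> * (\<delta>^3 / 6) \<le> 2*B * (\<delta>^3 / 6)"
    using \<open>\<delta> > 0\<close> by (intro mult_right_mono) auto
  also have "\<dots> = B * \<delta>^3 / 3" by simp
  finally show ?thesis .
qed

lemma symmetric_difference_quintic:
  fixes g :: "nat \<Rightarrow> real \<Rightarrow> real"
  assumes d: "\<And>k x. k < 5 \<Longrightarrow> (g k has_real_derivative g (Suc k) x) (at x)" and "\<delta> > 0"
    and b: "\<And>x. \<bar>x - v\<bar> \<le> \<delta> \<Longrightarrow> \<bar>g 5 x\<bar> \<le> B"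
  shows "\<bar>g 0 (v+\<delta>) - g 0 (v-\<delta>) - 2*\<delta>*g 1 v - \<delta>^3/3 * g 3 v\<bar> \<le> B * \<delta>^5 / 60"
proof -
  have "\<exists>t. v < t \<and> t < v+\<delta> \<and>
     g 0 (v+\<delta>) = (\<Sum>m<5. (g m v / fact m) * (v+\<delta>-v)^m) + (g 5 t / fact 5) * (v+\<delta>-v)^5"
    by (rule Taylor_up[of 5 g "g 0" v]) (simp_all add: assms)
  then obtain t where t: "v < t" "t < v+\<delta>" 
     "g 0 (v+\<delta>) = (\<Sum>m<5. (g m v / fact m) * (v+\<delta>-v)^m) + (g 5 t / fact 5) * (v+\<delta>-v)^5" by blast
  have "\<exists>s. v-\<delta> < s \<and> s < v \<and>
     g 0 (v-\<delta>) = (\<Sum>m<5. (g m v / fact m) * (v-\<delta>-v)^m) + (g 5 s / fact 5) * (v-\<delta>-v)^5"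
    by (rule Taylor_down[of 5 g "g 0" _ v]) (simp_all add: assms)
  then obtain s where s: "v-\<delta> < s" "s < v" 
     "g 0 (v-\<delta>) = (\<Sum>m<5. (g m v / fact m) * (v-\<delta>-v)^m) + (g 5 s / fact 5) * (v-\<delta>-v)^5" by blast
  have dd: "v+\<delta>-v = \<delta>" "v-\<delta>-v = -\<delta>" by simp_all
  have "g 0 (v+\<delta>) - g 0 (v-\<delta>) - 2*\<delta>*g 1 v - \<delta>^3/3 * g 3 v = (g 5 t + g 5 s) * \<delta>^5 / 120"
    unfolding t(3) s(3) dd by (simp add: eval_nat_numeral) (simp add: algebra_simps)
  hence "\<bar>g 0 (v+\<delta>) - g 0 (v-\<delta>) - 2*\<delta>*g 1 v - \<delta>^3/3 * g 3 v\<bar> = \<bar>g 5 t + g 5 s\<bar> * (\<delta>^5 / 120)"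
    using \<open>\<delta> > 0\<close> by (simp only: abs_mult abs_divide) simp
  also have "\<bar>g 5 t + g 5 s\<bar> \<le> 2*B" using b[of t] b[of s] t s \<open>\<delta> > 0\<close> by linarith
  hence "\<bar>g 5 t + g 5 s\<bar> * (\<delta>^5 / 120) \<le> 2*B * (\<delta>^5 / 120)"
    using \<open>\<delta> > 0\<close> by (intro mult_right_mono) auto
  also have "\<dots> = B * \<delta>^5 / 60" by simp
  finally show ?thesis .
qed

text \<open>
  The linearisation in \<open>1 / N\<close> of \<open>\<Phi> (v + (5 v + v^3) / (24 N))\<close>. It has the advantage that its derivative
  is the normal density times a polynomial.
\<close>
definition edgeworth :: "real \<Rightarrow> real \<Rightarrow> real" where
  "edgeworth N v = std_normal_cdf v + (5 * v + v^3) * std_normal_density v / (24 * N)"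

lemma edgeworth_minus: "edgeworth N (- v) = 1 - edgeworth N v"
proof -
  have "(- v)^3 = - (v^3)" by simp
  hence h: "5 * (- v) + (- v)^3 = - (5 * v + v^3)" by simp
  have neg: "(- p) * f / c = - (p * f / c)" for p f c :: real by simp
  show ?thesis unfolding edgeworth_def std_normal_cdf_minus std_normal_density_minus h neg by simp
qed

text \<open>
  Moves a bound from an arbitrary point \<open>x\<close> of a cell to the centre \<open>v\<close> of the cell. The factor
  \<open>1 / (1 + v^2)\<close> is what makes the errors of the cells summable.
\<close>
lemma weighted_density_bound:
  assumes "\<bar>x - v\<bar> \<le> 1/10" "(1 + x^2) * (p * std_normal_density x) \<le> C" "\<bar>q\<bar> \<le> p" "0 \<le> C"
  shows "\<bar>q * std_normal_density x\<bar> \<le> 2 * C / (1 + v^2)"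
proof -
  have "v^2 \<le> 2*x^2 + 2*(x-v)^2"
    using zero_le_power2[of "2*x-v"] by (simp add: power2_eq_square algebra_simps)
  moreover have "(x-v)^2 \<le> (1/10)^2" using assms(1) by (metis abs_ge_zero power2_abs power_mono)
  ultimately have v: "1 + v^2 \<le> 2*(1+x^2)" by (simp add: power2_eq_square)
  have p: "1 + v^2 > 0" "1 + x^2 > 0" by (simp_all add: add_pos_nonneg)
  have "\<bar>q * std_normal_density x\<bar> \<le> p * std_normal_density x"
    unfolding abs_mult using assms(3) by (intro mult_mono) auto
  also have "\<dots> \<le> C / (1 + x^2)" using assms(2) p by (simp add: pos_le_divide_eq mult.commute)
  also have "\<dots> = 2 * C / (2*(1+x^2))" by (rule mult_divide_mult_cancel_left[symmetric]) simp
  also have "\<dots> \<le> 2 * C / (1 + v^2)"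
    using v p assms(4) by (intro divide_left_mono mult_pos_pos) auto
  finally show ?thesis .
qed

text \<open>
  The term of third order has to be kept: with \<open>\<delta>^2 = 1 / (2 N)\<close> it is as large as the contribution of the
  Edgeworth correction.
\<close>
lemma std_normal_cell:
  assumes "0 < \<delta>" "\<delta> \<le> 1/10"
  shows "\<bar>std_normal_cdf (v+\<delta>) - std_normal_cdf (v-\<delta>) - 2*\<delta> * std_normal_density v
     - \<delta>^3/3 * ((v^2-1) * std_normal_density v)\<bar> \<le> 3 * \<delta>^5 / (1 + v^2)"
proof -
  define g where "g = (\<lambda>k::nat. if k = 0 then std_normal_cdf else if k = 1 then (\<lambda>v. 1 * std_normal_density v)
    else if k = 2 then (\<lambda>v. (-v) * std_normal_density v)
    else if k = 3 then (\<lambda>v. (v^2-1) * std_normal_density v)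
    else if k = 4 then (\<lambda>v. (3* v - v^3) * std_normal_density v)
    else (\<lambda>v. (v^4 - 6* v^2 + 3) * std_normal_density v))"
  have "(g k has_real_derivative g (Suc k) x) (at x)" if k: "k < 5" for k x
  proof -
    have "k = 0 \<or> k = 1 \<or> k = 2 \<or> k = 3 \<or> k = 4" using k by linarith
    then consider "k = 0" | "k = 1" | "k = 2" | "k = 3" | "k = 4" by blast
    thus ?thesis
    proof cases
      case 1 thus ?thesis unfolding g_def using DERIV_std_normal_cdf by simp
    next
      case 2
      have "((\<lambda>v. 1 * std_normal_density v) has_real_derivative (0 - x * 1) * std_normal_density x) (at x)"
        by (rule DERIV_poly_std_normal) auto
      thus ?thesis unfolding g_def 2 by simp
    next
      case 3
      have "((\<lambda>v. (-v) * std_normal_density v) has_real_derivative (-1 - x * (-x)) * std_normal_density x) (at x)"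
        by (rule DERIV_poly_std_normal) (auto intro!: derivative_eq_intros)
      moreover have "-1 - x * (-x) = x^2 - 1" by (simp add: power2_eq_square)
      ultimately show ?thesis unfolding g_def 3 by simp
    next
      case 4
      have "((\<lambda>v. (v^2-1) * std_normal_density v) has_real_derivative (2*x - x * (x^2-1)) * std_normal_density x) (at x)"
        by (rule DERIV_poly_std_normal) (auto intro!: derivative_eq_intros)
      moreover have "2*x - x * (x^2-1) = 3*x - x^3" by (simp add: eval_nat_numeral algebra_simps)
      ultimately show ?thesis unfolding g_def 4 by simp
    next
      case 5
      have "((\<lambda>v. (3* v-v^3) * std_normal_density v) has_real_derivative (3 - 3*x^2 - x * (3*x-x^3)) * std_normal_density x) (at x)"
        by (rule DERIV_poly_std_normal) (auto intro!: derivative_eq_intros)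
      moreover have "3 - 3*x^2 - x * (3*x-x^3) = x^4 - 6*x^2 + 3" by (simp add: eval_nat_numeral algebra_simps)
      ultimately show ?thesis unfolding g_def 5 by simp
    qed
  qed
  moreover have "\<bar>g 5 x\<bar> \<le> 2 * 63 / (1 + v^2)" if "\<bar>x - v\<bar> \<le> \<delta>" for x
  proof -
    have "\<bar>(x^4 - 6*x^2 + 3) * std_normal_density x\<bar> \<le> 2 * 63 / (1 + v^2)"
    proof (rule weighted_density_bound[where p="x^4+6*x^2+3"])
      show "\<bar>x - v\<bar> \<le> 1/10" using that assms by linarith
      have "(1 + x^2) * ((x^4+6*x^2+3) * std_normal_density x) = 3 * std_normal_density x
         + 9 * (x^2 * std_normal_density x) + 7 * (x^4 * std_normal_density x) + x^6 * std_normal_density x"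
        by (simp add: algebra_simps power_add[symmetric])
      thus "(1 + x^2) * ((x^4+6*x^2+3) * std_normal_density x) \<le> 63"
        using std_normal_weight_bounds(2-5)[of x] by linarith
      have "0 \<le> x^4" "0 \<le> x^2" by simp_all
      thus "\<bar>x^4 - 6*x^2 + 3\<bar> \<le> x^4+6*x^2+3" by (simp only: abs_le_iff) argo
    qed auto
    thus ?thesis unfolding g_def by simp
  qed
  ultimately have "\<bar>g 0 (v+\<delta>) - g 0 (v-\<delta>) - 2*\<delta>*g 1 v - \<delta>^3/3 * g 3 v\<bar> \<le> 2 * 63 / (1 + v^2) * \<delta>^5 / 60"
    using assms(1) by (intro symmetric_difference_quintic) auto
  also have "\<dots> \<le> 3 * \<delta>^5 / (1 + v^2)"
  proof -
    have bound: "2 * 63 / w * d / 60 \<le> 3 * d / w" if "w > 0" "d \<ge> 0" for w d :: real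
      using that by (simp add: field_simps)
    show ?thesis by (rule bound) (use assms in \<open>simp_all add: add_pos_nonneg\<close>)
  qed
  finally show ?thesis unfolding g_def by simp
qed

text \<open>The correction carries a factor \<open>1 / N\<close>, so an error of order \<open>\<delta>^3\<close> is enough here.\<close>
lemma edgeworth_correction_cell:
  assumes "0 < \<delta>" "\<delta> \<le> 1/10"
  defines "\<psi> \<equiv> \<lambda>v. (5* v + v^3) * std_normal_density v"
  shows "\<bar>\<psi> (v+\<delta>) - \<psi> (v-\<delta>) - 2*\<delta> * ((5 - 2* v^2 - v^4) * std_normal_density v)\<bar> \<le> 300 * \<delta>^3 / (1 + v^2)"
proof -
  define g where "g = (\<lambda>k::nat. if k = 0 then \<psi> else if k = 1 then (\<lambda>v. (5 - 2* v^2 - v^4) * std_normal_density v)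
    else if k = 2 then (\<lambda>v. (v^5 - 2* v^3 - 9* v) * std_normal_density v)
    else (\<lambda>v. (7* v^4 + 3* v^2 - v^6 - 9) * std_normal_density v))"
  have "(g k has_real_derivative g (Suc k) x) (at x)" if k: "k < 3" for k x
  proof -
    have "k = 0 \<or> k = 1 \<or> k = 2" using k by linarith
    then consider "k = 0" | "k = 1" | "k = 2" by blast
    thus ?thesis
    proof cases
      case 1
      have "((\<lambda>v. (5* v+v^3) * std_normal_density v) has_real_derivative ((5 + 3*x^2) - x * (5*x+x^3)) * std_normal_density x) (at x)"
        by (rule DERIV_poly_std_normal) (auto intro!: derivative_eq_intros)
      moreover have "(5 + 3*x^2) - x * (5*x+x^3) = 5 - 2*x^2 - x^4" by (simp add: eval_nat_numeral algebra_simps)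
      ultimately show ?thesis unfolding g_def 1 \<psi>_def by simp
    next
      case 2
      have d: "((\<lambda>v. (5 - 2* v^2 - v^4) * std_normal_density v) has_real_derivative ((-4*x - 4*x^3) - x * (5 - 2*x^2 - x^4)) * std_normal_density x) (at x)"
        by (rule DERIV_poly_std_normal) (auto intro!: derivative_eq_intros)
      have e: "(-4*x - 4*x^3) - x * (5 - 2*x^2 - x^4) = x^5 - 2*x^3 - 9*x" by (simp add: eval_nat_numeral algebra_simps)
      show ?thesis using d[unfolded e] unfolding g_def 2 by simp
    next
      case 3
      have "((\<lambda>v. (v^5 - 2* v^3 - 9* v) * std_normal_density v) has_real_derivative ((5*x^4 - 6*x^2 - 9) - x * (x^5 - 2*x^3 - 9*x)) * std_normal_density x) (at x)"
        by (rule DERIV_poly_std_normal) (auto intro!: derivative_eq_intros)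
      moreover have "(5*x^4 - 6*x^2 - 9) - x * (x^5 - 2*x^3 - 9*x) = 7*x^4 + 3*x^2 - x^6 - 9" by (simp add: eval_nat_numeral algebra_simps)
      ultimately show ?thesis unfolding g_def 3 by simp
    qed
  qed
  moreover have "\<bar>g 3 x\<bar> \<le> 2 * 450 / (1 + v^2)" if "\<bar>x - v\<bar> \<le> \<delta>" for x
  proof -
    have "\<bar>(7*x^4 + 3*x^2 - x^6 - 9) * std_normal_density x\<bar> \<le> 2 * 450 / (1 + v^2)"
    proof (rule weighted_density_bound[where p="x^6+7*x^4+3*x^2+9"])
      show "\<bar>x - v\<bar> \<le> 1/10" using that assms by linarith
      have "(1 + x^2) * ((x^6+7*x^4+3*x^2+9) * std_normal_density x) = 9 * std_normal_density x
         + 12 * (x^2 * std_normal_density x) + 10 * (x^4 * std_normal_density x) + 8 * (x^6 * std_normal_density x)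
         + x^8 * std_normal_density x"
        by (simp add: algebra_simps power_add[symmetric])
      thus "(1 + x^2) * ((x^6+7*x^4+3*x^2+9) * std_normal_density x) \<le> 450"
        using std_normal_weight_bounds(2-6)[of x] by linarith
      have "0 \<le> x^4" "0 \<le> x^2" "0 \<le> x^6" by simp_all
      thus "\<bar>7*x^4 + 3*x^2 - x^6 - 9\<bar> \<le> x^6+7*x^4+3*x^2+9" by (simp only: abs_le_iff) argo
    qed auto
    thus ?thesis unfolding g_def by simp
  qed
  ultimately have "\<bar>g 0 (v+\<delta>) - g 0 (v-\<delta>) - 2*\<delta>*g 1 v\<bar> \<le> 2 * 450 / (1 + v^2) * \<delta>^3 / 3"
    using assms(1) by (intro symmetric_difference_cubic) auto
  also have "2 * 450 / (1 + v^2) * \<delta>^3 / 3 = 300 * \<delta>^3 / (1 + v^2)"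
  proof -
    have "2 * 450 / w * d / 3 = 300 * d / w" for w d :: real by simp
    thus ?thesis .
  qed
  finally show ?thesis unfolding g_def by simp
qed

text \<open>
  This is where the coefficients of the correction are used: its derivative contributes
  \<open>5 - 2 v^2 - v^4\<close>, the third-order term of the cell contributes \<open>2 v^2 - 2\<close>, and the sum \<open>3 - v^4\<close> is the
  polynomial in the expansion \<open>sym_binom_approx\<close> of the binomial mass.
\<close>
lemma edgeworth_cell:
  assumes "N \<ge> 100"
  defines "\<delta> \<equiv> sqrt (2/N) / 2"
  shows "\<bar>edgeworth N (v+\<delta>) - edgeworth N (v-\<delta>) - 2*\<delta> * (std_normal_density v * (1 + (3 - v^4)/(24*N)))\<bar>
     \<le> 2*\<delta> * (5 / (N^2 * (1 + v^2)))"
proof -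
  have N: "N > 0" using assms by simp
  \<comment> \<open>\<open>\<delta>\<close> is half the width of a cell in the scale of \<open>v\<close>.\<close>
  have d2: "\<delta>^2 = 1 / (2*N)" unfolding \<delta>_def using N by (simp add: power_divide)
  have d0: "\<delta> > 0" unfolding \<delta>_def using N by simp
  have d1: "\<delta> \<le> 1/10"
  proof (rule power2_le_imp_le)
    show "\<delta>^2 \<le> (1/10)^2" unfolding d2 using assms by (simp add: divide_simps)
  qed simp
  have d3: "\<delta>^3 = \<delta> / (2*N)" "\<delta>^5 = \<delta> / (4*N^2)"
  proof -
    have "\<delta>^3 = \<delta> * \<delta>^2" "\<delta>^5 = \<delta> * (\<delta>^2)^2" by (simp_all add: eval_nat_numeral)
    thus "\<delta>^3 = \<delta> / (2*N)" "\<delta>^5 = \<delta> / (4*N^2)" unfolding d2 by (simp_all add: power2_eq_square)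
  qed
  define f where "f = std_normal_density v"
  define A where "A = std_normal_cdf (v+\<delta>) - std_normal_cdf (v-\<delta>) - 2*\<delta> * f - \<delta>^3/3 * ((v^2-1) * f)"
  define B where "B = (5*(v+\<delta>) + (v+\<delta>)^3) * std_normal_density (v+\<delta>) - (5*(v-\<delta>) + (v-\<delta>)^3) * std_normal_density (v-\<delta>)
     - 2*\<delta> * ((5 - 2* v^2 - v^4) * f)"
  define w where "w = 1 + v^2"
  have w: "w > 0" unfolding w_def by (simp add: add_pos_nonneg)
  have A: "\<bar>A\<bar> \<le> 3 * \<delta>^5 / w" unfolding A_def f_def w_def by (rule std_normal_cell[OF d0 d1])
  have B: "\<bar>B\<bar> \<le> 300 * \<delta>^3 / w" unfolding B_def f_def w_def by (rule edgeworth_correction_cell[OF d0 d1])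
  have "edgeworth N (v+\<delta>) - edgeworth N (v-\<delta>) = A + 2*\<delta>*f + \<delta>^3/3 * ((v^2-1) * f) + (B + 2*\<delta> * ((5 - 2* v^2 - v^4) * f)) / (24*N)"
    unfolding edgeworth_def A_def B_def by (simp add: diff_divide_distrib)
  also have "\<dots> = A + B / (24*N) + 2*\<delta> * (f * (1 + (3 - v^4)/(24*N)))"
    unfolding d3 using N by (simp add: field_simps)
  finally have "edgeworth N (v+\<delta>) - edgeworth N (v-\<delta>) - 2*\<delta> * (f * (1 + (3 - v^4)/(24*N))) = A + B / (24*N)" by simp
  also have "\<bar>A + B / (24*N)\<bar> \<le> \<bar>A\<bar> + \<bar>B\<bar> / (24*N)" using N abs_triangle_ineq[of A "B/(24*N)"] by simp
  also have "\<dots> \<le> 3 * \<delta>^5 / w + 300 * \<delta>^3 / w / (24*N)"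
    using A B N by (intro add_mono divide_right_mono) auto
  also have "\<dots> = 7 * (\<delta> / (N^2 * w))" unfolding d3 using N w by (simp add: field_simps power2_eq_square)
  also have "\<dots> \<le> 10 * (\<delta> / (N^2 * w))" using d0 w by (intro mult_right_mono) auto
  also have "\<dots> = 2*\<delta> * (5 / (N^2 * w))" by simp
  finally show ?thesis unfolding f_def w_def .
qed

lemma sym_binom_cell:
  assumes "m \<ge> 1" "(m+1) div 2 \<le> j"
  defines "N \<equiv> (real m + 1)/2"
  defines "\<delta> \<equiv> sqrt (2/N) / 2"
  defines "v \<equiv> (real j - real m / 2) * (2*\<delta>)"
  assumes "N \<ge> 100" "v^4 \<le> N"
  shows "\<bar>sym_binom m j - (edgeworth N (v+\<delta>) - edgeworth N (v-\<delta>))\<bar> \<le> 2*\<delta> * (16000 / (N^2 * (1 + v^2)))"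
proof -
  have N: "N > 0" using assms by simp
  have d0: "\<delta> > 0" unfolding \<delta>_def using N by simp
  have s: "sqrt (2/N) = 2*\<delta>" unfolding \<delta>_def by simp
  define w where "w = 1 + v^2"
  have w: "w > 0" unfolding w_def by (simp add: add_pos_nonneg)
  have v: "v = (real j - real m / 2) * sqrt (2/N)" unfolding v_def s ..
  have "\<bar>sym_binom m j - 2*\<delta> * (std_normal_density v * (1 + (3 - v^4)/(24*N)))\<bar>
      \<le> 2*\<delta> * (std_normal_density v * (5 * (1 + v^8) / N^2))"
    using sym_binom_approx[OF assms(1,2), folded N_def, folded v, OF assms(6,7)] unfolding s .
  also have "\<dots> \<le> 2*\<delta> * (15000 / (N^2 * w))"
  proof (intro mult_left_mono)
    have "w * ((1 + v^8) * std_normal_density v) \<le> 3000" unfolding w_def by (rule std_normal_weight_bounds)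
    hence "(1 + v^8) * std_normal_density v \<le> 3000 / w" using w by (simp add: pos_le_divide_eq mult.commute)
    hence "5 / N^2 * ((1 + v^8) * std_normal_density v) \<le> 5 / N^2 * (3000 / w)" using N by (intro mult_left_mono) auto
    thus "std_normal_density v * (5 * (1 + v^8) / N^2) \<le> 15000 / (N^2 * w)" by (simp add: mult_ac)
  qed (use d0 in simp)
  finally have 1: "\<bar>sym_binom m j - 2*\<delta> * (std_normal_density v * (1 + (3 - v^4)/(24*N)))\<bar> \<le> 2*\<delta> * (15000 / (N^2 * w))" .
  have 2: "\<bar>edgeworth N (v+\<delta>) - edgeworth N (v-\<delta>) - 2*\<delta> * (std_normal_density v * (1 + (3 - v^4)/(24*N)))\<bar>
     \<le> 2*\<delta> * (5 / (N^2 * w))" unfolding w_def \<delta>_def using edgeworth_cell[OF assms(6)] .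
  define q where "q = \<delta> / (N^2 * w)"
  have q: "q \<ge> 0" unfolding q_def using d0 w by simp
  have e: "2*\<delta> * (c / (N^2 * w)) = 2*c*q" for c unfolding q_def by simp
  have triangle: "\<bar>p - x\<bar> \<le> r" if "\<bar>p - c\<bar> \<le> a" "\<bar>x - c\<bar> \<le> b" "a + b \<le> r" for p x c a b r :: real
    using that by linarith
  show ?thesis unfolding w_def[symmetric] e
    by (rule triangle[OF 1[unfolded e] 2[unfolded e]]) (use q in simp)
qed

section \<open>The binomial distribution function\<close>

definition sym_binom_cdf :: "nat \<Rightarrow> nat \<Rightarrow> real" where
  "sym_binom_cdf m k = (\<Sum>j\<le>k. sym_binom m j)"

lemma sym_binom_cdf_reflect:
  assumes "k < m" shows "sym_binom_cdf m k + sym_binom_cdf m (m - 1 - k) = 1"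
proof -
  have "sym_binom_cdf m (m-1-k) = (\<Sum>j\<in>{k<..m}. sym_binom m j)"
    unfolding sym_binom_cdf_def
    by (rule sum.reindex_bij_witness[of _ "\<lambda>j. m - j" "\<lambda>j. m - j"])
       (use assms in \<open>auto simp: sym_binom_def binomial_symmetric[symmetric]\<close>)
  moreover have "(\<Sum>j\<le>m. sym_binom m j) = sym_binom_cdf m k + (\<Sum>j\<in>{k<..m}. sym_binom m j)"
  proof -
    have "{..m} = {..k} \<union> {k<..m}" using assms by auto
    moreover have "sum (sym_binom m) ({..k} \<union> {k<..m}) = sum (sym_binom m) {..k} + sum (sym_binom m) {k<..m}"
      by (rule sum.union_disjoint) auto
    ultimately show ?thesis unfolding sym_binom_cdf_def by metis
  qed
  moreover have "(\<Sum>j\<le>m. sym_binom m j) = 1"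
  proof -
    have "(\<Sum>j\<le>m. sym_binom m j) = real (\<Sum>j\<le>m. m choose j) / 2^m"
      by (simp add: sym_binom_def sum_divide_distrib)
    thus ?thesis unfolding choose_row_sum by simp
  qed
  ultimately show ?thesis by simp
qed

text \<open>
  Summed over the cells, the weight \<open>1 / (1 + v^2)\<close> is dominated by the total increment of the bounded function
  \<open>x / (1 + x)\<close>, so the accumulated error does not grow with the number of cells.
\<close>
lemma cell_weight_telescopes:
  fixes v \<delta> :: real assumes "0 < \<delta>" "\<delta> \<le> v"
  shows "2*\<delta> / (1 + v^2) \<le> 2 * ((v+\<delta>)/(1+(v+\<delta>)) - (v-\<delta>)/(1+(v-\<delta>)))"
proof -
  have v: "v > 0" using assms by simp
  have "(v+\<delta>)/(1+(v+\<delta>)) - (v-\<delta>)/(1+(v-\<delta>)) = 2*\<delta> / ((1+(v+\<delta>)) * (1+(v-\<delta>)))"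
    using assms v by (simp add: field_simps)
  also have "\<dots> \<ge> 2*\<delta> / (2 * (1+v^2))"
  proof (intro divide_left_mono)
    have "0 \<le> (1-v)^2" "0 \<le> \<delta>^2" by simp_all
    moreover have "2 * (1+v^2) - (1+(v+\<delta>)) * (1+(v-\<delta>)) = (1-v)^2 + \<delta>^2"
      by (simp add: power2_eq_square algebra_simps)
    ultimately show "(1+(v+\<delta>)) * (1+(v-\<delta>)) \<le> 2 * (1+v^2)" by linarith
    show "0 < 2 * (1 + v\<^sup>2) * ((1 + (v + \<delta>)) * (1 + (v - \<delta>)))" using assms v
      by (intro mult_pos_pos add_pos_nonneg) auto
  qed (use assms in auto)
  finally have "2*\<delta> / (2 * (1+v^2)) \<le> (v+\<delta>)/(1+(v+\<delta>)) - (v-\<delta>)/(1+(v-\<delta>))" .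
  moreover have "x / w = 2 * (x / (2 * w))" for x w :: real by simp
  ultimately show ?thesis by (metis mult_left_mono zero_le_numeral)
qed

text \<open>
  Both functions are known at the centre by symmetry. For odd \<open>m\<close> the first cell begins at \<open>0\<close>, where they have
  the common value \<open>1/2\<close>; for even \<open>m\<close> the first cell is centred at \<open>0\<close> and half of its error counts. The
  errors of the further cells telescope.
\<close>
lemma sym_binom_cdf_upper_half:
  assumes "m \<ge> 1" "(m+1) div 2 \<le> k"
  defines "N \<equiv> (real m + 1)/2"
  defines "\<delta> \<equiv> sqrt (2/N) / 2"
  defines "u \<equiv> \<lambda>k. (real k + 1/2 - real m / 2) * (2*\<delta>)"
  assumes "N \<ge> 100" "u k ^ 4 \<le> N"
  shows "\<bar>sym_binom_cdf m k - edgeworth N (u k)\<bar> \<le> 32000 / N^2 * (u k / (1 + u k))"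
  using assms(2,7)
proof (induction k rule: dec_induct)
  case base
  have N: "N > 0" using assms by simp
  have d0: "\<delta> > 0" unfolding \<delta>_def using N by simp
  define n where "n = (m+1) div 2"
  define v where "v = (real n - real m / 2) * (2*\<delta>)"
  have uv: "u n = v + \<delta>" unfolding u_def v_def by (simp add: algebra_simps)
  have "real n - real m / 2 \<ge> 0" unfolding n_def by linarith
  hence v0: "v \<ge> 0" unfolding v_def using d0 by simp
  have "v^4 \<le> (u n)^4" unfolding uv using v0 d0 by (intro power_mono) auto
  also have "\<dots> \<le> N" using base unfolding n_def .
  finally have v4: "v^4 \<le> N" .
  define e where "e = sym_binom m n - (edgeworth N (v+\<delta>) - edgeworth N (v-\<delta>))"
  have e: "\<bar>e\<bar> \<le> 2*\<delta> * (16000 / (N^2 * (1 + v^2)))"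
    unfolding e_def using sym_binom_cell[OF assms(1), of n, folded N_def, folded \<delta>_def, folded v_def, OF _ assms(6) v4]
    unfolding n_def by simp
  show ?case unfolding n_def[symmetric]
  proof (cases "even m")
    case True
    hence mn: "m = 2*n" unfolding n_def by auto
    have n1: "n \<ge> 1" using mn assms(1) by simp
    have v: "v = 0" unfolding v_def mn by simp
    have "sym_binom_cdf m n + sym_binom_cdf m (n-1) = 1"
      using sym_binom_cdf_reflect[of n m] n1 unfolding mn by simp
    moreover have "sym_binom_cdf m n = sym_binom_cdf m (n-1) + sym_binom m n"
      unfolding sym_binom_cdf_def using n1 by (cases n) auto
    ultimately have "sym_binom_cdf m n = 1/2 + sym_binom m n / 2" by simp
    moreover have "edgeworth N (-\<delta>) = 1 - edgeworth N \<delta>" by (rule edgeworth_minus)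
    ultimately have ee: "sym_binom_cdf m n - edgeworth N \<delta> = e / 2" unfolding e_def v by simp
    have "\<bar>sym_binom_cdf m n - edgeworth N \<delta>\<bar> = \<bar>e\<bar>/2" unfolding ee by simp
    also have "\<dots> \<le> 16000 / N^2 * \<delta>" using e unfolding v by (simp add: field_simps)
    also have "\<dots> \<le> 32000 / N^2 * (\<delta> / (1+\<delta>))"
    proof -
      have "\<delta> \<le> 1"
      proof (rule power2_le_imp_le)
        show "\<delta>^2 \<le> 1^2" unfolding \<delta>_def using assms(6) by (simp add: power_divide divide_simps)
      qed simp
      hence "\<delta> \<le> 2 * (\<delta> / (1+\<delta>))" using d0 by (simp add: field_simps)
      hence "16000 / N^2 * \<delta> \<le> 16000 / N^2 * (2 * (\<delta> / (1+\<delta>)))" by (intro mult_left_mono) auto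
      thus ?thesis by simp
    qed
    finally show "\<bar>sym_binom_cdf m n - edgeworth N (u n)\<bar> \<le> 32000 / N^2 * (u n / (1 + u n))"
      unfolding uv v by simp
  next
    case False
    hence mn: "m + 1 = 2*n" unfolding n_def by auto
    have n1: "n \<ge> 1" using mn by simp
    have rm: "real m = 2 * real n - 1" using mn by linarith
    have v: "v = \<delta>" unfolding v_def rm by (simp add: field_simps)
    have "m - 1 - (n-1) = n-1" "n - 1 < m" using mn n1 by auto
    hence "sym_binom_cdf m (n-1) = 1/2"
      using sym_binom_cdf_reflect[of "n-1" m] by simp
    moreover have "sym_binom_cdf m n = sym_binom_cdf m (n-1) + sym_binom m n"
      unfolding sym_binom_cdf_def using n1 by (cases n) auto
    moreover have "edgeworth N 0 = 1/2" using edgeworth_minus[of N 0] by simp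
    ultimately have "sym_binom_cdf m n - edgeworth N (u n) = e" unfolding e_def uv v by simp
    hence "\<bar>sym_binom_cdf m n - edgeworth N (u n)\<bar> \<le> 2*\<delta> * (16000 / (N^2 * (1 + v^2)))" using e by simp
    also have "\<dots> = 16000 / N^2 * (2*\<delta> / (1 + v^2))" by simp
    also have "\<dots> \<le> 16000 / N^2 * (2 * ((v+\<delta>)/(1+(v+\<delta>)) - (v-\<delta>)/(1+(v-\<delta>))))"
      by (intro mult_left_mono cell_weight_telescopes) (use d0 v in auto)
    also have "\<dots> = 32000 / N^2 * (u n / (1 + u n))" unfolding uv v by simp
    finally show "\<bar>sym_binom_cdf m n - edgeworth N (u n)\<bar> \<le> 32000 / N^2 * (u n / (1 + u n))" .
  qed
next
  case (step k)
  have N: "N > 0" using assms by simp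
  have d0: "\<delta> > 0" unfolding \<delta>_def using N by simp
  define v where "v = (real (Suc k) - real m / 2) * (2*\<delta>)"
  have uv: "u (Suc k) = v + \<delta>" "u k = v - \<delta>" unfolding u_def v_def by (simp_all add: algebra_simps)
  have "real k - real m / 2 \<ge> 0" using step(1) by linarith
  hence vd: "v \<ge> \<delta>" 
  proof -
    assume "real k - real m / 2 \<ge> 0"
    hence "1 * \<delta> \<le> (2 * (real (Suc k) - real m / 2)) * \<delta>" using d0 by (intro mult_right_mono) auto
    thus ?thesis unfolding v_def by (simp add: mult_ac)
  qed
  have "v^4 \<le> (u (Suc k))^4" unfolding uv using vd d0 by (intro power_mono) auto
  also have "\<dots> \<le> N" using step(4) .
  finally have v4: "v^4 \<le> N" .
  have "(u k)^4 \<le> (u (Suc k))^4" unfolding uv using vd d0 by (intro power_mono) auto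
  also have "\<dots> \<le> N" using step(4) .
  finally have IH: "\<bar>sym_binom_cdf m k - edgeworth N (v-\<delta>)\<bar> \<le> 32000 / N^2 * ((v-\<delta>) / (1 + (v-\<delta>)))"
    using step(3) unfolding uv by simp
  have "\<bar>sym_binom m (Suc k) - (edgeworth N (v+\<delta>) - edgeworth N (v-\<delta>))\<bar> \<le> 2*\<delta> * (16000 / (N^2 * (1 + v^2)))"
    using sym_binom_cell[OF assms(1), of "Suc k", folded N_def, folded \<delta>_def, folded v_def, OF _ assms(6) v4] step(1) by simp
  also have "\<dots> = 16000 / N^2 * (2*\<delta> / (1 + v^2))" by simp
  also have "\<dots> \<le> 16000 / N^2 * (2 * ((v+\<delta>)/(1+(v+\<delta>)) - (v-\<delta>)/(1+(v-\<delta>))))"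
    by (intro mult_left_mono cell_weight_telescopes) (use d0 vd in auto)
  also have "\<dots> = 32000 / N^2 * ((v+\<delta>)/(1+(v+\<delta>))) - 32000 / N^2 * ((v-\<delta>)/(1+(v-\<delta>)))"
    by (simp add: algebra_simps)
  finally have e: "\<bar>sym_binom m (Suc k) - (edgeworth N (v+\<delta>) - edgeworth N (v-\<delta>))\<bar> \<le> 
      32000 / N^2 * ((v+\<delta>)/(1+(v+\<delta>))) - 32000 / N^2 * ((v-\<delta>)/(1+(v-\<delta>)))" .
  have "sym_binom_cdf m (Suc k) = sym_binom_cdf m k + sym_binom m (Suc k)" unfolding sym_binom_cdf_def by simp
  thus ?case unfolding uv using IH e by linarith
qed

lemma sym_binom_cdf_edgeworth:
  assumes "m \<ge> 1" "k < m"
  defines "N \<equiv> (real m + 1)/2"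
  defines "u \<equiv> (real k + 1/2 - real m / 2) * sqrt (2/N)"
  assumes "N \<ge> 100" "u ^ 4 \<le> N"
  shows "\<bar>sym_binom_cdf m k - edgeworth N u\<bar> \<le> 32000 / N^2"
proof -
  define \<delta> where "\<delta> = sqrt (2/N) / 2"
  have N: "N > 0" using assms by simp
  have d0: "\<delta> > 0" unfolding \<delta>_def using N by simp
  define U where "U = (\<lambda>k. (real k + 1/2 - real m / 2) * (2*\<delta>))"
  have Uk: "U k = u" unfolding U_def u_def \<delta>_def by simp
  have main: "\<bar>sym_binom_cdf m j - edgeworth N (U j)\<bar> \<le> 32000 / N^2" if j: "(m+1) div 2 \<le> j" "U j ^ 4 \<le> N" for j
  proof -
    have "real j + 1/2 - real m / 2 \<ge> 0" using j(1) by linarith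
    hence U0: "U j \<ge> 0" unfolding U_def using d0 by simp
    have "\<bar>sym_binom_cdf m j - edgeworth N (U j)\<bar> \<le> 32000 / N^2 * (U j / (1 + U j))"
      using sym_binom_cdf_upper_half[OF assms(1) j(1), folded N_def, folded \<delta>_def, OF assms(5)] j(2) unfolding U_def by simp
    also have "\<dots> \<le> 32000 / N^2 * 1" using U0 by (intro mult_left_mono) (auto simp: divide_simps)
    finally show ?thesis by simp
  qed
  show ?thesis
  proof (cases "(m+1) div 2 \<le> k")
    case True thus ?thesis using main[of k] assms(6) unfolding Uk by simp
  next
    case False
    define j where "j = m - 1 - k"
    have rj: "real j = real m - 1 - real k" unfolding j_def using assms(2) by (simp add: of_nat_diff)
    have Uj: "U j = - u" unfolding Uk[symmetric] U_def rj by (simp add: algebra_simps)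
    have c: "sym_binom_cdf m k + sym_binom_cdf m j = 1" unfolding j_def by (rule sym_binom_cdf_reflect[OF assms(2)])
    have em: "edgeworth N (-u) = 1 - edgeworth N u" by (rule edgeworth_minus)
    show ?thesis
    proof (cases "(m+1) div 2 \<le> j")
      case True
      have "\<bar>sym_binom_cdf m j - edgeworth N (-u)\<bar> \<le> 32000 / N^2" using main[OF True] assms(6) unfolding Uj by simp
      thus ?thesis using c em by linarith
    next
      case F: False
      with False have "2 * k + 1 = m" unfolding j_def using assms(2) by linarith
      hence jk: "j = k" and "real k + 1/2 - real m / 2 = 0" unfolding j_def by auto
      hence "u = 0" unfolding u_def by simp
      hence "sym_binom_cdf m k - edgeworth N u = 0" using c em jk by simp
      thus ?thesis by simp
    qed
  qed
qed

text \<open>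
  The inverse, up to terms of order \<open>1 / N^2\<close>, of the map
  \<open>z \<mapsto> sqrt (m / (2 N)) * (z + (z - z^3) / (12 m))\<close>, which is the polynomial transport of the theorem in the
  scale of \<open>v\<close>.
\<close>
definition inverse_transport :: "real \<Rightarrow> real \<Rightarrow> real" where
  "inverse_transport N v = v + (5 * v + v^3) / (24 * N)"

lemma inverse_transport_minus: "inverse_transport N (- v) = - inverse_transport N v"
proof -
  have "(- v)^3 = - (v^3)" by simp
  hence h: "5 * (- v) + (- v)^3 = - (5 * v + v^3)" by simp
  have neg: "(- p) / c = - (p / c)" for p c :: real by simp
  show ?thesis unfolding inverse_transport_def h neg by simp
qed

text \<open>
  The Taylor remainder is \<open>t * \<phi> t * d^2 / 2\<close> at some \<open>t \<ge> v\<close>, where \<open>d\<close> is the displacement. As \<open>d\<close> increases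
  with \<open>v\<close>, it may be evaluated at \<open>t\<close>, and the Gaussian factor bounds the resulting polynomial.
\<close>
lemma std_normal_cdf_inverse_transport:
  assumes "N > 0"
  shows "\<bar>std_normal_cdf (inverse_transport N v) - edgeworth N v\<bar> \<le> 1 / N^2"
proof -
  have main: "\<bar>std_normal_cdf (inverse_transport N v) - edgeworth N v\<bar> \<le> 1 / N^2" if v: "v \<ge> 0" for v
  proof (cases "v = 0")
    case True thus ?thesis unfolding inverse_transport_def edgeworth_def by simp
  next
    case False
    with v have v: "v > 0" by simp
    define d where "d = (5 * v + v^3) / (24 * N)"
    have d: "d > 0" unfolding d_def using v assms by (intro divide_pos_pos add_pos_pos) auto
    define g where "g = (\<lambda>k::nat. if k = 0 then std_normal_cdf else if k = 1 then std_normal_density else (\<lambda>v. - v * std_normal_density v))"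
    have "(g k has_real_derivative g (Suc k) x) (at x)" if k: "k < 2" for k x
    proof -
      have "k = 0 \<or> k = 1" using k by linarith
    then consider "k = 0" | "k = 1" by blast
      thus ?thesis by cases (simp_all add: g_def DERIV_std_normal_cdf DERIV_std_normal_density[simplified])
    qed
    hence "\<exists>t. v < t \<and> t < v+d \<and> g 0 (v+d) = (\<Sum>m<2. (g m v / fact m) * (v+d-v)^m) + (g 2 t / fact 2) * (v+d-v)^2"
      using d by (intro Taylor_up[of 2 g "g 0" v]) auto
    then obtain t where t: "v < t" "t < v+d" 
      "g 0 (v+d) = (\<Sum>m<2. (g m v / fact m) * (v+d-v)^m) + (g 2 t / fact 2) * (v+d-v)^2" by blast
    have "g 0 (v+d) = g 0 v + g 1 v * d + g 2 t * d^2 / 2"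
      unfolding t(3) by (simp add: eval_nat_numeral)
    hence eq: "std_normal_cdf (inverse_transport N v) - edgeworth N v = - (t * std_normal_density t * d^2 / 2)"
      unfolding g_def inverse_transport_def edgeworth_def d_def[symmetric] by (simp add: d_def)
    have t0: "t > 0" using t v by simp
    have "t * std_normal_density t * d^2 = t * std_normal_density t * (5 * v + v^3)^2 / (576 * N^2)"
      unfolding d_def by (simp add: power_divide power_mult_distrib)
    also have "\<dots> \<le> t * std_normal_density t * (5 * t + t^3)^2 / (576 * N^2)"
      using t v t0 by (intro divide_right_mono mult_left_mono power_mono add_mono mult_left_mono) auto
    also have "t * std_normal_density t * (5 * t + t^3)^2 = 25 * (t^3 * std_normal_density t)
       + 10 * (t^5 * std_normal_density t) + t^7 * std_normal_density t"
      by (simp add: eval_nat_numeral algebra_simps)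
    also have "\<dots> \<le> 25 * ((1+t^4) * std_normal_density t)
       + 10 * ((1+t^6) * std_normal_density t) + (1+t^8) * std_normal_density t"
      using t0 by (intro add_mono mult_left_mono mult_right_mono power_le_one_plus_power) auto
    also have "\<dots> = 36 * std_normal_density t + 25 * (t^4 * std_normal_density t) + 10 * (t^6 * std_normal_density t) + t^8 * std_normal_density t"
      by (simp add: algebra_simps)
    also have "\<dots> \<le> 576" using std_normal_weight_bounds(2-6)[of t] by linarith
    finally have "t * std_normal_density t * d^2 \<le> 576 / (576 * N^2)" by (simp add: divide_right_mono)
    hence "t * std_normal_density t * d^2 \<le> 1 / N^2" by simp
    moreover have "0 \<le> 1 / N^2" by simp
    ultimately have "t * std_normal_density t * d^2 / 2 \<le> 1 / N^2" by linarith
    moreover have "t * std_normal_density t * d^2 / 2 \<ge> 0" using t0 by simp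
    ultimately show ?thesis unfolding eq by simp
  qed
  show ?thesis
  proof (cases "v \<ge> 0")
    case False
    have "\<bar>std_normal_cdf (inverse_transport N (-v)) - edgeworth N (-v)\<bar> \<le> 1 / N^2" using main[of "-v"] False by simp
    thus ?thesis unfolding inverse_transport_minus std_normal_cdf_minus edgeworth_minus by linarith
  qed (use main in simp)
qed

lemma sym_binom_cdf_normal:
  assumes "m \<ge> 1" "k < m"
  defines "N \<equiv> (real m + 1)/2"
  defines "u \<equiv> (real k + 1/2 - real m / 2) * sqrt (2/N)"
  assumes "N \<ge> 100" "u ^ 4 \<le> N"
  shows "\<bar>sym_binom_cdf m k - std_normal_cdf (inverse_transport N u)\<bar> \<le> 33000 / N^2"
proof -
  have "\<bar>sym_binom_cdf m k - edgeworth N u\<bar> \<le> 32000 / N^2"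
    using sym_binom_cdf_edgeworth[OF assms(1,2)] assms(5,6) unfolding N_def u_def by simp
  moreover have "\<bar>std_normal_cdf (inverse_transport N u) - edgeworth N u\<bar> \<le> 1 / N^2"
    by (rule std_normal_cdf_inverse_transport) (use assms in simp)
  ultimately have "\<bar>sym_binom_cdf m k - std_normal_cdf (inverse_transport N u)\<bar> \<le> 32000 * (1/ N^2) + 1 / N^2" by simp
  also have "\<dots> \<le> 33000 * (1/N^2)"
  proof -
    have bound: "32000 * r + r \<le> 33000 * r" if "r \<ge> 0" for r :: real using that by linarith
    show ?thesis by (rule bound) simp
  qed
  finally show ?thesis by simp
qed

section \<open>Inverting the transport map\<close>

lemma sqrt_one_minus_bounds:
  fixes y :: real assumes "0 \<le> y" "y \<le> 1/2"
  shows "sqrt (1 - y) \<le> 1 - y/2" "1 - y/2 - y^2 \<le> sqrt (1 - y)"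
proof -
  show "sqrt (1 - y) \<le> 1 - y/2"
  proof (rule real_le_lsqrt)
    show "1 - y \<le> (1 - y/2)^2" by (simp add: power2_eq_square algebra_simps)
  qed (use assms in auto)
  show "1 - y/2 - y^2 \<le> sqrt (1 - y)"
  proof (rule real_le_rsqrt)
    have "(1 - y) - (1 - y/2 - y^2)^2 = y^2 * (7/4 - y - y^2)"
      by (simp add: eval_nat_numeral algebra_simps)
    moreover have "y^2 \<le> (1/2)^2" using assms by (intro power_mono) auto
    hence "7/4 - y - y^2 \<ge> 0" using assms by (simp add: power2_eq_square)
    ultimately show "(1 - y/2 - y^2)^2 \<le> 1 - y"
      by (metis diff_ge_0_iff_ge mult_nonneg_nonneg zero_le_power2)
  qed
qed

text \<open>
  Here \<open>sqrt (m / (2 N)) = sqrt (1 - 1 / (2 N))\<close> contributes \<open>- z / (4 N) = - 6 z / (24 N)\<close>, which turns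
  \<open>z - z^3\<close> into \<open>- (5 z + z^3)\<close>.
\<close>
lemma transport_linearised:
  fixes N z m :: real
  assumes "N \<ge> 1" "m = 2*N - 1"
  defines "v \<equiv> sqrt (m/(2*N)) * (z + (z - z^3) / (12*m))"
  shows "\<bar>v - (z - (5 * z + z^3)/(24*N))\<bar> \<le> (1+\<bar>z\<bar>)^3 / (2*N^2)"
proof -
  define R where "R = 1 + \<bar>z\<bar>"
  define q where "q = z - z^3"
  have R: "R \<ge> 1" unfolding R_def by simp
  have zR: "\<bar>z\<bar> \<le> R^3"
  proof -
    have "\<bar>z\<bar> \<le> R^1" unfolding R_def by simp
    also have "\<dots> \<le> R^3" using R by (intro power_increasing) auto
    finally show ?thesis .
  qed
  have qR: "\<bar>q\<bar> \<le> R^3"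
  proof -
    have "\<bar>q\<bar> \<le> \<bar>z\<bar> + \<bar>z\<bar>^3" unfolding q_def using abs_triangle_ineq4[of z "z^3"] by (simp add: power_abs)
    also have "\<dots> \<le> R^3"
    proof -
      have "R^3 = 1 + 3*\<bar>z\<bar> + 3*\<bar>z\<bar>^2 + \<bar>z\<bar>^3" unfolding R_def by (simp add: eval_nat_numeral algebra_simps)
      thus ?thesis using zero_le_power2[of "\<bar>z\<bar>"] abs_ge_zero[of z] by linarith
    qed
    finally show ?thesis .
  qed
  have N: "N > 0" using assms by simp
  have m: "m \<ge> N" "m > 0" using assms by auto
  define y where "y = 1/(2*N)"
  have y: "0 \<le> y" "y \<le> 1/2" unfolding y_def using assms(1) by (auto simp: divide_simps)
  have mN: "m/(2*N) = 1 - y" unfolding y_def assms(2) using N by (simp add: field_simps)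
  define r1 where "r1 = 1 - y/2 - sqrt (1 - y)"
  have r1: "0 \<le> r1" "r1 \<le> 1/(4*N^2)"
  proof -
    show "0 \<le> r1" unfolding r1_def using sqrt_one_minus_bounds(1)[OF y] by simp
    have "r1 \<le> y^2" unfolding r1_def using sqrt_one_minus_bounds(2)[OF y] by simp
    also have "y^2 = 1/(4*N^2)" unfolding y_def by (simp add: power_divide power_mult_distrib)
    finally show "r1 \<le> 1/(4*N^2)" .
  qed
  define r2 where "r2 = 1/(12*m) - 1/(24*N)"
  have r2: "0 \<le> r2" "r2 \<le> 1/(24*N^2)"
  proof -
    have e: "r2 = 1/(24*N*m)" unfolding r2_def using N m(2) assms(2) by (simp add: field_simps)
    show "0 \<le> r2" unfolding e using N m by simp
    have "1/(24*N*m) \<le> 1/(24*N*N)" using N m by (intro divide_left_mono mult_left_mono mult_pos_pos) auto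
    thus "r2 \<le> 1/(24*N^2)" unfolding e by (simp add: power2_eq_square)
  qed
  have s: "sqrt (m/(2*N)) = 1 - y/2 - r1" unfolding mN r1_def by simp
  have t: "z + (z - z^3)/(12*m) = z + q/(24*N) + r2*q" unfolding r2_def q_def using N m by (simp add: field_simps)
  have y4: "y/2 = 1/(4*N)" unfolding y_def by simp
  have eq: "v - (z - (5 * z + z^3)/(24*N)) = - (r1 * z) + r2 * q - (1/(4*N) + r1) * (q * (1/(24*N) + r2))"
  proof -
    have "5 * z + z^3 = 6 * z - q" unfolding q_def by simp
    moreover have "(6 * z - q)/(24*N) = z * (1/(4*N)) - q * (1/(24*N))" by (simp add: diff_divide_distrib)
    moreover have "q/(24*N) = q * (1/(24*N))" by simp
    ultimately show ?thesis unfolding v_def s t y4 by (simp only:) (simp only: algebra_simps)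
  qed
  \<comment> \<open>Every term is at most of order \<open>h^2\<close>: so are \<open>r1\<close> and \<open>r2\<close>, and the last product has two factors of order \<open>h\<close>.\<close>
  define h where "h = 1/N"
  have h: "0 < h" "h \<le> 1" unfolding h_def using assms(1) by (auto simp: divide_simps)
  have hh: "1/(4*N^2) = h^2/4" "1/(24*N^2) = h^2/24" "1/(4*N) = h/4" "1/(24*N) = h/24" "R^3/(2*N^2) = h^2/2*R^3"
    unfolding h_def by (simp_all add: power_divide)
  have h2: "h^2 \<le> h" using h by (simp add: power2_eq_square mult_left_le)
  have R3: "R^3 \<ge> 0" using R by simp
  have a1: "\<bar>r1 * z\<bar> \<le> h^2/4 * R^3"
    unfolding abs_mult using r1 zR unfolding hh by (intro mult_mono) auto
  have a2: "\<bar>r2 * q\<bar> \<le> h^2/24 * R^3"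
    unfolding abs_mult using r2 qR unfolding hh by (intro mult_mono) auto
  have a3: "\<bar>(h/4 + r1) * (q * (h/24 + r2))\<bar> \<le> h/2 * (R^3 * (h/12))"
    unfolding abs_mult using r1 r2 qR h h2 R3 unfolding hh by (intro mult_mono) auto
  have "h/2 * (R^3 * (h/12)) = h^2/24 * R^3" by (simp add: power2_eq_square)
  note a3 = a3[unfolded this]
  have triangle: "\<bar>- a + b - c\<bar> \<le> \<bar>a\<bar> + \<bar>b\<bar> + \<bar>c\<bar>" for a b c :: real by linarith
  have "\<bar>v - (z - (5 * z + z^3)/(24*N))\<bar> \<le> \<bar>r1 * z\<bar> + \<bar>r2 * q\<bar> + \<bar>(h/4 + r1) * (q * (h/24 + r2))\<bar>"
    unfolding eq hh by (rule triangle)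
  also have "\<dots> \<le> h^2/4 * R^3 + h^2/24 * R^3 + h^2/24 * R^3" using a1 a2 a3 by linarith
  also have "\<dots> \<le> h^2/2 * R^3"
  proof -
    have "x/4 * c + x/24 * c + x/24 * c \<le> x/2 * c" if "x * c \<ge> 0" for x c :: real using that by argo
    thus ?thesis using R3 by simp
  qed
  finally show ?thesis unfolding R_def[symmetric] hh .
qed

text \<open>
  By \<open>transport_linearised\<close> the correction \<open>(5 v + v^3) / (24 N)\<close> would undo the transport if it were taken at
  \<open>z\<close>. Taking it at \<open>v\<close> changes it by order \<open>\<bar>v - z\<bar> / N\<close>, and \<open>\<bar>v - z\<bar>\<close> is itself of order \<open>1 / N\<close>.
\<close>
lemma inverse_transport_transport:
  fixes N z m :: real
  assumes "N \<ge> 1" "m = 2*N - 1" "(1 + \<bar>z\<bar>)^3 \<le> N"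
  defines "v \<equiv> sqrt (m/(2*N)) * (z + (z - z^3) / (12*m))"
  shows "\<bar>inverse_transport N v - z\<bar> \<le> (1+\<bar>z\<bar>)^5 / N^2" "\<bar>v\<bar> \<le> 1 + \<bar>z\<bar>"
proof -
  define R where "R = 1 + \<bar>z\<bar>"
  have N: "N > 0" using assms by simp
  have R: "R \<ge> 1" "\<bar>z\<bar> \<le> R" unfolding R_def by auto
  have e1: "\<bar>v - (z - (5 * z + z^3)/(24*N))\<bar> \<le> R^3 / (2*N^2)"
    unfolding R_def v_def by (rule transport_linearised[OF assms(1,2)])
  have p: "\<bar>5 * z + z^3\<bar> \<le> 5 * R^3"
  proof -
    have "\<bar>5 * z + z^3\<bar> \<le> 5*\<bar>z\<bar> + \<bar>z\<bar>^3" using abs_triangle_ineq[of "5 * z" "z^3"] by (simp add: power_abs)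
    also have "\<dots> \<le> 5 * R^3"
    proof -
      have "R^3 = 1 + 3*\<bar>z\<bar> + 3*\<bar>z\<bar>^2 + \<bar>z\<bar>^3" unfolding R_def by (simp add: eval_nat_numeral algebra_simps)
      moreover have "0 \<le> \<bar>z\<bar>^3" by simp
      ultimately show ?thesis using zero_le_power2[of "\<bar>z\<bar>"] abs_ge_zero[of z] by linarith
    qed
    finally show ?thesis .
  qed
  have vz: "\<bar>v - z\<bar> \<le> R^3 / N"
  proof -
    have "\<bar>(5 * z + z^3)/(24*N)\<bar> \<le> 5 * R^3 / (24*N)" unfolding abs_divide using p N by (simp add: divide_right_mono)
    moreover have "R^3 / (2*N^2) \<le> R^3 / (2*N)" using R N assms(1)
      by (intro divide_left_mono) (auto simp: power2_eq_square)
    moreover have "R^3 / (2*N) = 1/2 * (R^3/N)" "5 * R^3 / (24*N) = 5/24 * (R^3/N)" by simp_all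
    moreover have "R^3/N \<ge> 0" using R N by simp
    ultimately show ?thesis using e1 by linarith
  qed
  have "R^3 / N \<le> 1" using assms(3) N unfolding R_def by simp
  with vz have "\<bar>v - z\<bar> \<le> 1" by linarith
  thus vR: "\<bar>v\<bar> \<le> 1 + \<bar>z\<bar>" by linarith
  have d: "(5 * v + v^3) - (5 * z + z^3) = (v - z) * (5 + v^2 + v * z + z^2)"
    by (simp add: eval_nat_numeral algebra_simps)
  have "24*N > 0" using N by simp
  have "\<bar>5 + v^2 + v * z + z^2\<bar> \<le> 8 * R^2"
  proof -
    have "v^2 \<le> R^2" "z^2 \<le> R^2" using vR R unfolding R_def[symmetric] by (metis abs_le_square_iff abs_of_nonneg order_trans abs_ge_zero)+
    moreover have "\<bar>v * z\<bar> \<le> R * R" unfolding abs_mult using vR R unfolding R_def[symmetric] by (intro mult_mono) auto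
    moreover have "1 \<le> R^2" using R by simp
    moreover have "0 \<le> v^2" "0 \<le> z^2" by simp_all
    ultimately show ?thesis unfolding power2_eq_square[of R] by linarith
  qed
  hence "\<bar>(5 * v + v^3) - (5 * z + z^3)\<bar> \<le> R^3/N * (8 * R^2)"
    unfolding d abs_mult using vz R N by (intro mult_mono) auto
  hence "\<bar>((5 * v + v^3) - (5 * z + z^3))/(24*N)\<bar> \<le> R^3/N * (8 * R^2) / (24*N)"
    unfolding abs_divide abs_of_pos[OF \<open>24*N > 0\<close>] by (rule divide_right_mono) (use N in simp)
  also have "\<dots> = 1/3 * (R^5/N^2)" by (simp add: eval_nat_numeral)
  finally have e2: "\<bar>((5 * v + v^3) - (5 * z + z^3))/(24*N)\<bar> \<le> 1/3 * (R^5/N^2)" .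
  have "R^3 \<le> R^5" using R by (intro power_increasing) auto
  hence "R^3 / (2*N^2) \<le> R^5/(2*N^2)" by (intro divide_right_mono) auto
  also have "\<dots> = 1/2 * (R^5/N^2)" by simp
  finally have e3: "R^3 / (2*N^2) \<le> 1/2 * (R^5/N^2)" .
  have "inverse_transport N v - z = (v - (z - (5 * z + z^3)/(24*N))) + ((5 * v + v^3) - (5 * z + z^3))/(24*N)"
    unfolding inverse_transport_def by (simp add: diff_divide_distrib)
  moreover have "0 \<le> R^5/N^2" using R by simp
  ultimately have "\<bar>inverse_transport N v - z\<bar> \<le> R^5/N^2" using e1 e2 e3 by linarith
  thus "\<bar>inverse_transport N v - z\<bar> \<le> (1+\<bar>z\<bar>)^5 / N^2" unfolding R_def .
qed

lemma std_normal_density_antimono: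
  assumes "\<bar>x\<bar> \<le> r" shows "std_normal_density r \<le> std_normal_density x"
proof -
  have "x^2 \<le> r^2" using assms by (simp add: abs_le_square_iff[symmetric])
  thus ?thesis unfolding std_normal_density_def by (intro mult_left_mono) auto
qed

lemma std_normal_cdf_increment:
  assumes "a < b" "\<bar>a\<bar> \<le> r" "\<bar>b\<bar> \<le> r"
  shows "(b - a) * std_normal_density r \<le> std_normal_cdf b - std_normal_cdf a"
proof -
  obtain x where x: "a < x" "x < b" "std_normal_cdf b - std_normal_cdf a = (b - a) * std_normal_density x"
    using MVT2[OF assms(1) DERIV_std_normal_cdf] by blast
  have "std_normal_density r \<le> std_normal_density x"
    by (rule std_normal_density_antimono) (use x assms in linarith)
  thus ?thesis unfolding x(3) using assms(1) by (intro mult_left_mono) auto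
qed

lemma inverse_transport_expanding:
  assumes "N > 0" "a \<le> b" shows "b - a \<le> inverse_transport N b - inverse_transport N a"
proof -
  have "a^3 \<le> b^3" by (rule power_mono_odd) (use assms in auto)
  hence "(5 * a + a^3)/(24*N) \<le> (5 * b + b^3)/(24*N)" using assms by (intro divide_right_mono) auto
  thus ?thesis unfolding inverse_transport_def by simp
qed

lemma ln_ge_17: "(3 * 10^7 :: real) \<le> x \<Longrightarrow> 17 \<le> ln x"
proof -
  assume x: "3 * 10^7 \<le> x"
  have "exp (17::real) = exp 1 ^ 17" by (simp add: exp_of_nat_mult[symmetric])
  also have "\<dots> \<le> (272/100)^17" using e_less_272 by (intro power_mono) auto
  also have "\<dots> \<le> 3 * 10^7" by (simp add: power_divide)
  finally have "exp 17 \<le> x" using x by simp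
  thus ?thesis using x by (subst ln_ge_iff) auto
qed

text \<open>
  As \<open>m = exp (y^2)\<close>, powers of \<open>y\<close> are small compared with \<open>m\<close>. The bound on the fourth power keeps the range
  \<open>\<bar>z\<bar> \<le> y\<close>, with a margin of \<open>2\<close>, inside \<open>v^4 \<le> N\<close>; the bound on the tenth power controls the error
  \<open>(1 + \<bar>z\<bar>)^5 / N^2\<close> of the inversion.
\<close>
lemma log_range_bounds:
  fixes m N :: real
  assumes "m \<ge> 3 * 10^7" "N = (m + 1)/2"
  defines "y \<equiv> sqrt (ln m)"
  shows "4 \<le> y" "(y + 2)^4 \<le> N" "(y + 2)^10 \<le> 14000 * N"
proof -
  define x where "x = ln m"
  have x: "17 \<le> x" unfolding x_def by (rule ln_ge_17[OF assms(1)])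
  have y2: "y^2 = x" unfolding y_def x_def using x unfolding x_def by simp
  show y4: "4 \<le> y" unfolding y_def x_def[symmetric] by (rule real_le_rsqrt) (use x in simp)
  have m: "m = exp x" unfolding x_def using assms(1) by simp
  have pe: "x^n \<le> fact n * m" for n
  proof -
    have "x^n * exp (-x) * exp x \<le> fact n * exp x" using exp_minus_le_power[of x n] x by (intro mult_right_mono) auto
    thus ?thesis unfolding m by (simp add: mult.assoc exp_minus)
  qed
  have "(y + 2)^4 \<le> (3/2 * y)^4" using y4 by (intro power_mono) auto
  also have "\<dots> = (3/2)^4 * (y^2)^2" by (simp only: power_mult_distrib power_mult[symmetric]) simp
  also have "\<dots> = 81/16 * (y^2)^2" by (simp add: power_divide)
  also have "\<dots> = 81/16 * x^2" unfolding y2 ..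
  also have "\<dots> \<le> 17^2/48 * x^2" by (intro mult_right_mono) auto
  also have "\<dots> \<le> x^2/48 * x^2" using x by (intro mult_right_mono divide_right_mono power_mono) auto
  also have "\<dots> = x^4 / 48" by (simp add: eval_nat_numeral)
  also have "\<dots> \<le> m / 2" using pe[of 4] by (simp add: fact_numeral)
  also have "\<dots> \<le> N" unfolding assms(2) by simp
  finally show "(y + 2)^4 \<le> N" .
  have "(y + 2)^10 \<le> (3/2 * y)^10" using y4 by (intro power_mono) auto
  also have "\<dots> = (3/2)^10 * (y^2)^5" by (simp only: power_mult_distrib power_mult[symmetric]) simp
  also have "\<dots> = (3/2)^10 * x^5" unfolding y2 ..
  also have "\<dots> \<le> (3/2)^10 * (fact 5 * m)" by (intro mult_left_mono pe) auto
  also have "\<dots> \<le> 7000 * m" using assms(1) by (simp add: fact_numeral power_divide)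
  also have "\<dots> \<le> 14000 * N" unfolding assms(2) by simp
  finally show "(y + 2)^10 \<le> 14000 * N" .
qed

section \<open>The quantile coupling\<close>

lemma real_distribution_binomial_law:
  "real_distribution (binomial_law m (1/2))"
  unfolding binomial_law_def
  by (intro prob_space.real_distribution_distr measure_pmf.prob_space_axioms) simp

lemma cdf_binomial_law_nat: "cdf (binomial_law m (1/2)) (real k) = sym_binom_cdf m k"
proof -
  have "cdf (binomial_law m (1/2)) (real k) = measure (measure_pmf (binomial_pmf m (1/2))) {..k}"
    unfolding cdf_def binomial_law_def by (subst measure_distr) (auto intro!: arg_cong[where f="measure _"])
  also have "\<dots> = (\<Sum>j\<le>k. pmf (binomial_pmf m (1/2)) j)"
    by (rule measure_measure_pmf_finite) simp
  also have "\<dots> = (\<Sum>j\<le>k. sym_binom m j)"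
  proof (rule sum.cong)
    fix j assume "j \<in> {..k}"
    show "pmf (binomial_pmf m (1/2)) j = sym_binom m j"
    proof (cases "j \<le> m")
      case True
      have "pmf (binomial_pmf m (1/2)) j = real (m choose j) * (1/2)^j * (1 - 1/2)^(m-j)"
        by (rule pmf_binomial) auto
      also have "\<dots> = real (m choose j) * (1/2)^(j + (m-j))" by (simp add: power_add)
      also have "\<dots> = sym_binom m j" unfolding le_add_diff_inverse[OF True]
        by (simp add: sym_binom_def power_one_over)
      finally show ?thesis .
    next
      case False thus ?thesis by (simp add: sym_binom_def binomial_eq_0)
    qed
  qed simp
  finally show ?thesis unfolding sym_binom_cdf_def .
qed

text \<open>The binomial law charges no point strictly between \<open>k\<close> and \<open>k + 1\<close>.\<close>
lemma cdf_binomial_law_step: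
  assumes "x < real (Suc k)"
  shows "cdf (binomial_law m (1/2)) x \<le> sym_binom_cdf m k"
proof -
  have "cdf (binomial_law m (1/2)) x = measure (measure_pmf (binomial_pmf m (1/2))) {j. real j \<le> x}"
    unfolding cdf_def binomial_law_def by (subst measure_distr) (auto intro!: arg_cong[where f="measure _"])
  also have "\<dots> \<le> measure (measure_pmf (binomial_pmf m (1/2))) {j. real j \<le> real k}"
    by (intro measure_pmf.finite_measure_mono) (use assms in auto)
  also have "\<dots> = cdf (binomial_law m (1/2)) (real k)"
    unfolding cdf_def binomial_law_def by (subst measure_distr) (auto intro!: arg_cong[where f="measure _"])
  finally show ?thesis unfolding cdf_binomial_law_nat .
qed

lemma quantile_le_iff:
  assumes "real_distribution \<mu>" "0 < p" "p < 1"
  shows "quantile (cdf \<mu>) p \<le> x \<longleftrightarrow> p \<le> cdf \<mu> x"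
proof -
  interpret real_distribution \<mu> by fact
  interpret cdf_distribution \<mu> by unfold_locales
  show ?thesis unfolding quantile_def using pseudoinverse[OF assms(2,3), of x] by simp
qed

lemma std_normal_cdf_bounds: "0 < std_normal_cdf z" "std_normal_cdf z < 1"
proof -
  have "0 \<le> std_normal_cdf (z - 1)" unfolding std_normal_cdf_def by (rule std_normal.cdf_nonneg)
  also have "\<dots> < std_normal_cdf z" by (rule std_normal_cdf_strict_mono) simp
  finally show "0 < std_normal_cdf z" .
  have "std_normal_cdf z < std_normal_cdf (z + 1)" by (rule std_normal_cdf_strict_mono) simp
  also have "\<dots> \<le> 1" unfolding std_normal_cdf_def by (rule std_normal.cdf_bounded_prob)
  finally show "std_normal_cdf z < 1" .
qed

lemma std_normal_cdf_surj:
  assumes "0 < p" "p < 1" obtains a where "std_normal_cdf a = p"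
proof -
  have "\<forall>\<^sub>F x in at_bot. std_normal_cdf x < p"
    unfolding std_normal_cdf_def by (rule order_tendstoD(2)[OF std_normal.cdf_lim_at_bot assms(1)])
  then obtain a where a: "std_normal_cdf a < p" by (auto simp: eventually_at_bot_linorder)
  have "\<forall>\<^sub>F x in at_top. std_normal_cdf x > p"
    unfolding std_normal_cdf_def by (rule order_tendstoD(1)[OF std_normal.cdf_lim_at_top_prob assms(2)])
  then obtain b where b: "std_normal_cdf b > p" by (auto simp: eventually_at_top_linorder)
  have "a \<le> b" using a b std_normal_cdf_mono[of b a] by (cases "a \<le> b") auto
  moreover have "continuous_on {a..b} std_normal_cdf"
    by (intro continuous_at_imp_continuous_on ballI DERIV_isCont[OF DERIV_std_normal_cdf])
  ultimately obtain x where "std_normal_cdf x = p" using IVT'[of std_normal_cdf a p b] a b by auto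
  thus thesis by (rule that)
qed

text \<open>
  The event \<open>X \<le> x\<close> is \<open>\<Phi> Z \<le> F x\<close>. If \<open>F x\<close> is \<open>\<Phi> a\<close> for some \<open>a\<close>, this is the event \<open>Z \<le> a\<close>, of
  probability \<open>F x\<close>. The values \<open>0\<close> and \<open>1\<close> of \<open>F\<close> are treated separately because \<open>\<Phi>\<close> does not attain them.
\<close>
lemma (in prob_space) quantile_transform:
  assumes Z: "random_variable borel Z" and cdfZ: "cdf (distr M borel Z) = std_normal_cdf"
    and \<mu>: "real_distribution \<mu>"
  defines "X \<equiv> \<lambda>\<omega>. quantile (cdf \<mu>) (std_normal_cdf (Z \<omega>))"
  shows "X \<in> borel_measurable M" "distr M borel X = \<mu>"
proof -
  interpret \<mu>: real_distribution \<mu> by fact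
  have iff: "X \<omega> \<le> x \<longleftrightarrow> std_normal_cdf (Z \<omega>) \<le> cdf \<mu> x" for \<omega> x
    unfolding X_def by (rule quantile_le_iff[OF \<mu> std_normal_cdf_bounds])
  have [measurable]: "std_normal_cdf \<in> borel_measurable borel"
    by (intro borel_measurable_continuous_onI continuous_at_imp_continuous_on ballI DERIV_isCont[OF DERIV_std_normal_cdf])
  note Z[measurable]
  show meas: "X \<in> borel_measurable M"
    unfolding borel_measurable_iff_le iff by measurable
  show "distr M borel X = \<mu>"
  proof (rule cdf_unique)
    show "real_distribution (distr M borel X)" using meas by (rule real_distribution_distr)
    show "cdf (distr M borel X) = cdf \<mu>"
    proof
      fix x
      have "cdf (distr M borel X) x = prob {\<omega> \<in> space M. X \<omega> \<le> x}"
        unfolding cdf_def using meas by (subst measure_distr) (auto intro!: arg_cong[where f=prob])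
      also have "\<dots> = prob {\<omega> \<in> space M. std_normal_cdf (Z \<omega>) \<le> cdf \<mu> x}" unfolding iff ..
      also have "\<dots> = cdf \<mu> x"
      proof -
        consider "cdf \<mu> x = 0" | "cdf \<mu> x = 1" | "0 < cdf \<mu> x" "cdf \<mu> x < 1"
          using \<mu>.cdf_nonneg[of x] \<mu>.cdf_bounded_prob[of x] by fastforce
        thus ?thesis
        proof cases
          case 1
          have "{\<omega> \<in> space M. std_normal_cdf (Z \<omega>) \<le> 0} = {}" using std_normal_cdf_bounds(1) by (auto simp: not_le)
          thus ?thesis unfolding 1 by (simp only: measure_empty)
        next
          case 2
          have "{\<omega> \<in> space M. std_normal_cdf (Z \<omega>) \<le> 1} = space M" using std_normal_cdf_bounds(2) by (auto intro: less_imp_le)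
          thus ?thesis unfolding 2 by (simp add: prob_space)
        next
          case 3
          obtain a where a: "std_normal_cdf a = cdf \<mu> x" using std_normal_cdf_surj[OF 3] by blast
          have "std_normal_cdf z \<le> std_normal_cdf a \<longleftrightarrow> z \<le> a" for z
            using std_normal_cdf_mono[of z a] std_normal_cdf_strict_mono[of a z] by (cases "z \<le> a") auto
          hence "prob {\<omega> \<in> space M. std_normal_cdf (Z \<omega>) \<le> cdf \<mu> x} = prob {\<omega> \<in> space M. Z \<omega> \<le> a}"
            unfolding a[symmetric] by simp
          also have "\<dots> = cdf (distr M borel Z) a"
            unfolding cdf_def using Z by (subst measure_distr) (auto intro!: arg_cong[where f=prob])
          finally show ?thesis unfolding cdfZ a .
        qed
      qed
      finally show "cdf (distr M borel X) x = cdf \<mu> x" .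
    qed
  qed (rule \<mu>)
qed

text \<open>
  In the scale of \<open>z\<close> the shift by \<open>\<epsilon>\<close> is \<open>2 * \<eta>\<close>. One half of it pays for the error of the approximate inverse.
  The other half changes \<open>\<Phi>\<close> by at least \<open>\<eta> * \<phi> (y + \<eta>)\<close>, which is more than the error \<open>33000 / N^2\<close> between
  the distribution functions. The integers \<open>k\<close> concerned are the last one below \<open>T - \<epsilon> - 1/2\<close> and the last one
  not above \<open>T + \<epsilon> + 1/2\<close>.
\<close>
lemma sym_binom_cdf_vs_transport:
  fixes m :: nat and z :: real
  assumes m: "real m \<ge> 3 * 10^7" and z: "\<bar>z\<bar> \<le> sqrt (ln (real m))"
  defines "T \<equiv> real m / 2 + sqrt (real m) / 2 * z + (z - z^3) / (24 * sqrt (real m))"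
    and "\<epsilon> \<equiv> 2 * 20^6 / real m"
  shows "\<And>k::int. T - \<epsilon> - 3/2 \<le> of_int k \<Longrightarrow> of_int k < T - \<epsilon> - 1/2 \<Longrightarrow>
           0 \<le> k \<and> sym_binom_cdf m (nat k) < std_normal_cdf z"
    and "\<And>k::int. T + \<epsilon> - 1/2 \<le> of_int k \<Longrightarrow> of_int k \<le> T + \<epsilon> + 1/2 \<Longrightarrow>
           0 \<le> k \<and> std_normal_cdf z \<le> sym_binom_cdf m (nat k)"
proof -
  define N where "N = (real m + 1)/2"
  define y where "y = sqrt (ln (real m))"
  have y: "4 \<le> y" "(y + 2)^4 \<le> N" "(y + 2)^10 \<le> 14000 * N"
    using log_range_bounds[OF m N_def] unfolding y_def by auto
  have zy: "\<bar>z\<bar> \<le> y" using z unfolding y_def .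
  have mN: "real m = 2*N - 1" unfolding N_def by (simp add: field_simps)
  have N7: "N \<ge> 10^7" using m unfolding N_def by simp
  have N: "N > 0" "N \<ge> 1" "N \<ge> 100" using N7 by auto
  have m0: "real m > 0" "m \<ge> 1" using m by auto
  define c where "c = sqrt (2/N)"
  have c: "c > 0" "c^2 = 2/N" unfolding c_def using N by auto
  define v where "v = sqrt (real m/(2*N)) * (z + (z - z^3) / (12*real m))"
  have vT: "v = (T - real m / 2) * c"
  proof -
    have s: "sqrt (real m/(2*N)) = sqrt (real m) / 2 * c"
    proof -
      have "sqrt (real m/(2*N)) = sqrt (real m / 4 * (2/N))" by simp
      also have "\<dots> = sqrt (real m / 4) * c" unfolding c_def by (rule real_sqrt_mult)
      also have "sqrt (real m / 4) = sqrt (real m) / 2" by (simp add: real_sqrt_divide)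
      finally show ?thesis .
    qed
    have H: "sqrt (real m) / 2 * ((z - z^3) / (12*real m)) = (z - z^3) / (24 * sqrt (real m))"
    proof -
      have "r / 2 * (q / (12 * (r * r))) = q / (24 * r)" if "r > 0" for q r :: real
        using that by (simp add: field_simps)
      from this[of "sqrt (real m)" "z - z^3"] show ?thesis using m0 by simp
    qed
    have "T - real m / 2 = sqrt (real m) / 2 * (z + (z - z^3) / (12*real m))"
      unfolding T_def distrib_left H by simp
    thus ?thesis unfolding v_def s by simp
  qed
  define \<eta> where "\<eta> = \<epsilon> * c / 2"
  have eps: "\<epsilon> > 0" "\<epsilon> \<le> 5" unfolding \<epsilon>_def using m by (auto simp: divide_simps)
  have epsN: "\<epsilon> \<ge> 64 * (10^6 / N)" unfolding \<epsilon>_def mN using N m0 mN by (simp add: divide_simps)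
  have \<eta>: "\<eta> > 0" unfolding \<eta>_def using eps c by simp
  \<comment> \<open>\<open>c\<close> is the lattice spacing in the scale of \<open>v\<close>; together with \<open>y + 2 \<ge> 6\<close> the next bound makes it small.\<close>
  have c2: "c * (y + 2)^2 \<le> 2"
  proof (rule power2_le_imp_le)
    have "(c * (y + 2)^2)^2 = 2/N * (y+2)^4" unfolding power_mult_distrib c(2) by simp
    also have "\<dots> \<le> 2/N * N" using y(2) N by (intro mult_left_mono) auto
    also have "\<dots> \<le> 2^2" using N by simp
    finally show "(c * (y + 2)^2)^2 \<le> 2^2" .
  qed simp
  have c6: "c * (y + 2) * 6 \<le> 2"
  proof -
    have "c * (y + 2) * 6 \<le> c * (y + 2) * (y + 2)" using c y by (intro mult_left_mono) auto
    thus ?thesis using c2 by (simp add: power2_eq_square)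
  qed
  have c36: "c * 36 \<le> 2"
  proof -
    have "c * 6 * 6 \<le> c * (y + 2) * 6" using c y by (intro mult_right_mono mult_left_mono) auto
    thus ?thesis using c6 by simp
  qed
  have c_small: "c * (\<epsilon> + 1) \<le> 1"
  proof -
    have "c * (\<epsilon> + 1) \<le> c * 6" using eps c by (intro mult_left_mono) auto
    thus ?thesis using c36 by simp
  qed
  have cube: "(1 + \<bar>z\<bar>)^3 \<le> N"
  proof -
    have "(1 + \<bar>z\<bar>)^3 \<le> (y+2)^3" using zy y by (intro power_mono) auto
    also have "\<dots> \<le> (y+2)^4" using y by (intro power_increasing) auto
    finally show ?thesis using y by simp
  qed
  have cinv: "1 / N = c * (c / 2)" using c(2) by (simp add: power2_eq_square)
  have e5: "(1+\<bar>z\<bar>)^5 / N^2 \<le> \<eta>"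
  proof -
    have "(1 + \<bar>z\<bar>)^5 \<le> (y+2)^5" using zy y by (intro power_mono) auto
    moreover have "c * (y+2)^5 \<le> 10^6"
    proof (rule power2_le_imp_le)
      have "(c * (y + 2)^5)^2 = 2/N * (y+2)^10" unfolding power_mult_distrib c(2) by simp
      also have "\<dots> \<le> 2/N * (14000*N)" using y(3) N by (intro mult_left_mono) auto
      also have "\<dots> \<le> (10^6)^2" using N by simp
      finally show "(c * (y + 2)^5)^2 \<le> (10^6)^2" .
    qed simp
    moreover have "c * (1 + \<bar>z\<bar>)^5 \<le> c * (y+2)^5" using c calculation(1) by (intro mult_left_mono) auto
    ultimately have "c * (1 + \<bar>z\<bar>)^5 \<le> 10^6" by linarith
    hence "c * (1 + \<bar>z\<bar>)^5 * (c / 2 / N) \<le> 10^6 * (c / 2 / N)" using c N by (intro mult_right_mono) auto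
    also have "\<dots> = 10^6 / N * (c/2)" by simp
    also have "\<dots> \<le> \<epsilon> * (c/2)"
    proof (intro mult_right_mono)
      have "a \<le> e" if "64 * a \<le> e" "0 \<le> a" for a e :: real using that by linarith
      from this[OF epsN] show "10^6/N \<le> \<epsilon>" using N by simp
    qed (use c in simp)
    also have "\<dots> = \<eta>" unfolding \<eta>_def by simp
    also have "c * (1 + \<bar>z\<bar>)^5 * (c / 2 / N) = (1+\<bar>z\<bar>)^5 * (c * (c/2)) / N" by simp
    also have "\<dots> = (1+\<bar>z\<bar>)^5 / N^2" unfolding cinv[symmetric] by (simp add: power2_eq_square)
    finally show ?thesis .
  qed
  have inv: "\<bar>inverse_transport N v - z\<bar> \<le> \<eta>" "\<bar>v\<bar> \<le> 1 + \<bar>z\<bar>"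
    using order_trans[OF inverse_transport_transport(1)[OF N(2) mN cube] e5]
      inverse_transport_transport(2)[OF N(2) mN cube] unfolding v_def .
  \<comment> \<open>Since \<open>(y + \<eta>)^2 \<le> ln m + 2\<close>, the density at \<open>y + \<eta>\<close> is at least \<open>1 / (9 sqrt m)\<close>.\<close>
  have gauss: "33000 / N^2 < \<eta> * std_normal_density (y + \<eta>)"
  proof -
    have "\<eta> * 2 * (y + 2) \<le> \<epsilon> * (c * (y + 2))" unfolding \<eta>_def by simp
    also have "\<dots> \<le> 5 * (c * (y + 2))" using eps c y by (intro mult_right_mono) auto
    also have "\<dots> \<le> 2" 
    proof -
      have "0 \<le> c * (y+2)" using c y by simp
      thus ?thesis using c6 by linarith
    qed
    finally have 1: "\<eta> * 2 * (y + 2) \<le> 2" .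
    have "\<eta> * 2 * 6 \<le> \<eta> * 2 * (y + 2)" using \<eta> y by (intro mult_left_mono) auto
    hence "\<eta> \<le> 1" using 1 by simp
    hence "\<eta> * \<eta> \<le> \<eta> * 1" using \<eta> by (intro mult_left_mono) auto
    hence "(y + \<eta>)^2 \<le> y^2 + \<eta> * 2 * (y + 2)" using \<eta> by (simp add: power2_eq_square algebra_simps)
    hence "(y + \<eta>)^2 \<le> ln (real m) + 2" using 1 m unfolding y_def by simp
    hence "exp (- (ln (real m) + 2)/2) \<le> exp (- (y + \<eta>)\<^sup>2 / 2)" by simp
    moreover have "exp (- (ln (real m) + 2)/2) = 1 / (sqrt (real m) * exp 1)"
    proof -
      have "- (ln (real m) + 2)/2 = - (ln (sqrt (real m)) + 1)" using m0 by (simp add: ln_sqrt add_divide_distrib)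
      thus ?thesis using m0 by (simp only: exp_minus exp_add) (simp add: inverse_eq_divide)
    qed
    moreover have "1 / (sqrt (real m) * 3) \<le> 1 / (sqrt (real m) * exp 1)"
      using m0 exp_le by (intro divide_left_mono mult_left_mono) auto
    ultimately have "1 / (sqrt (real m) * 3) \<le> exp (- (y + \<eta>)\<^sup>2 / 2)" by linarith
    moreover have "1/3 \<le> 1 / sqrt (2*pi)"
    proof (intro divide_left_mono)
      show "sqrt (2*pi) \<le> 3" using pi_less_4 by (intro real_le_lsqrt) auto
    qed auto
    ultimately have "1/3 * (1 / (sqrt (real m) * 3)) \<le> std_normal_density (y + \<eta>)"
      unfolding std_normal_density_def by (intro mult_mono) auto
    moreover have "c / 18 \<le> 1/3 * (1 / (sqrt (real m) * 3))"
    proof -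
      have "c * sqrt (real m) = sqrt (2 * real m / N)" unfolding c_def real_sqrt_mult[symmetric] by simp
      also have "\<dots> \<le> sqrt (2^2)" using N mN by (intro real_sqrt_le_mono) (simp add: divide_simps)
      finally have "c * sqrt (real m) \<le> 2" by simp
      thus ?thesis using m0 by (simp add: divide_simps mult.commute)
    qed
    ultimately have "c / 18 \<le> std_normal_density (y + \<eta>)" by linarith
    hence "\<eta> * (c / 18) \<le> \<eta> * std_normal_density (y + \<eta>)" using \<eta> by (intro mult_left_mono) auto
    moreover have "\<eta> * (c / 18) = \<epsilon> / 18 * (c * (c/2))" unfolding \<eta>_def by simp
    hence "\<eta> * (c / 18) = \<epsilon> / 18 * (1 / N)" unfolding cinv[symmetric] .
    moreover have "64 * (10^6 / N) / 18 * (1/N) \<le> \<epsilon> / 18 * (1 / N)" 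
      using epsN N by (intro mult_right_mono divide_right_mono) auto
    moreover have "33000 / N^2 < 64 * (10^6 / N) / 18 * (1/N)" using N by (simp add: power2_eq_square divide_simps)
    ultimately show ?thesis by linarith
  qed
  \<comment> \<open>Lattice points near \<open>T\<close> lie in the range of the uniform estimate.\<close>
  have main: "0 \<le> k \<and> \<bar>sym_binom_cdf m (nat k) - std_normal_cdf (inverse_transport N ((of_int k + 1/2 - real m / 2) * c))\<bar> \<le> 33000 / N^2"
    if k: "\<bar>of_int k + 1/2 - T\<bar> \<le> \<epsilon> + 1" for k :: int
  proof -
    define u where "u = (of_int k + 1/2 - real m / 2) * c"
    have "u - v = (of_int k + 1/2 - T) * c" unfolding u_def vT by (simp add: algebra_simps)
    hence "\<bar>u - v\<bar> = \<bar>of_int k + 1/2 - T\<bar> * c" using c by (simp add: abs_mult)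
    also have "\<dots> \<le> (\<epsilon> + 1) * c" using k c by (intro mult_right_mono) auto
    finally have "\<bar>u - v\<bar> \<le> 1" using c_small by (simp add: mult.commute)
    hence uy: "\<bar>u\<bar> \<le> y + 2" using inv(2) zy by linarith
    have "\<bar>u\<bar>^4 \<le> (y+2)^4" using uy by (intro power_mono) auto
    hence u4: "u^4 \<le> N" using y(2) by simp
    have "\<bar>of_int k + 1/2 - real m / 2\<bar> * c = \<bar>u\<bar>" unfolding u_def using c by (simp add: abs_mult)
    also have "\<dots> \<le> y + 2" by (rule uy)
    also have "\<dots> \<le> N/2 * c"
    proof (rule power2_le_imp_le)
      have "36 * (y+2)^2 \<le> (y+2)^2 * (y+2)^2"
      proof (intro mult_right_mono)
        have "6^2 \<le> (y+2)^2" using y by (intro power_mono) auto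
        thus "36 \<le> (y+2)^2" by simp
      qed simp
      also have "\<dots> = (y+2)^4" by (simp add: power_add[symmetric])
      finally have "36 * (y+2)^2 \<le> N" using y(2) by linarith
      moreover have "(N/2 * c)^2 = N / 2" unfolding power_mult_distrib c(2) using N by (simp add: power2_eq_square)
      ultimately show "(y+2)^2 \<le> (N/2 * c)^2" using zero_le_power2[of "y+2"] by linarith
    qed (use N c in simp)
    finally have "\<bar>of_int k + 1/2 - real m / 2\<bar> \<le> N/2" using c by (simp only: mult_le_cancel_right_pos)
    moreover have "real m / 2 = N - 1/2" unfolding mN by (simp add: field_simps)
    ultimately have "0 \<le> real_of_int k" "real_of_int k < real m" unfolding abs_le_iff using N(3) mN by linarith+
    hence k0: "0 \<le> k" and km: "nat k < m" by linarith+
    have rk: "real (nat k) = of_int k" using k0 by simp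
    have "\<bar>sym_binom_cdf m (nat k) - std_normal_cdf (inverse_transport N u)\<bar> \<le> 33000 / N^2"
      using sym_binom_cdf_normal[OF m0(2) km, folded N_def, folded c_def, unfolded rk, folded u_def, OF N(3) u4] .
    thus ?thesis using k0 unfolding u_def by simp
  qed
  show "0 \<le> k \<and> sym_binom_cdf m (nat k) < std_normal_cdf z"
    if k: "T - \<epsilon> - 3/2 \<le> of_int k" "of_int k < T - \<epsilon> - 1/2" for k :: int
  proof -
    define u where "u = (of_int k + 1/2 - real m / 2) * c"
    have "\<bar>of_int k + 1/2 - T\<bar> \<le> \<epsilon> + 1" using k eps by linarith
    from main[OF this] have k0: "0 \<le> k" and b: "\<bar>sym_binom_cdf m (nat k) - std_normal_cdf (inverse_transport N u)\<bar> \<le> 33000 / N^2"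
      unfolding u_def by auto
    have "v - u = (T - (of_int k + 1/2)) * c" unfolding u_def vT by (simp add: algebra_simps)
    moreover have "\<epsilon> * c \<le> (T - (of_int k + 1/2)) * c" using k c by (intro mult_right_mono) auto
    ultimately have vu: "v - u \<ge> 2 * \<eta>" unfolding \<eta>_def by simp
    have "v - u \<le> inverse_transport N v - inverse_transport N u"
      by (rule inverse_transport_expanding[OF N(1)]) (use vu \<eta> in linarith)
    hence "inverse_transport N u \<le> z - \<eta>" using vu inv(1) by linarith
    hence "std_normal_cdf (inverse_transport N u) \<le> std_normal_cdf (z - \<eta>)" by (rule std_normal_cdf_mono)
    moreover have "(z - (z - \<eta>)) * std_normal_density (y + \<eta>) \<le> std_normal_cdf z - std_normal_cdf (z - \<eta>)"
      by (rule std_normal_cdf_increment) (use \<eta> zy in auto)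
    ultimately show ?thesis using gauss b k0 by simp
  qed
  show "0 \<le> k \<and> std_normal_cdf z \<le> sym_binom_cdf m (nat k)"
    if k: "T + \<epsilon> - 1/2 \<le> of_int k" "of_int k \<le> T + \<epsilon> + 1/2" for k :: int
  proof -
    define u where "u = (of_int k + 1/2 - real m / 2) * c"
    have "\<bar>of_int k + 1/2 - T\<bar> \<le> \<epsilon> + 1" using k eps by linarith
    from main[OF this] have k0: "0 \<le> k" and b: "\<bar>sym_binom_cdf m (nat k) - std_normal_cdf (inverse_transport N u)\<bar> \<le> 33000 / N^2"
      unfolding u_def by auto
    have "u - v = ((of_int k + 1/2) - T) * c" unfolding u_def vT by (simp add: algebra_simps)
    moreover have "\<epsilon> * c \<le> ((of_int k + 1/2) - T) * c" using k c by (intro mult_right_mono) auto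
    ultimately have vu: "u - v \<ge> 2 * \<eta>" unfolding \<eta>_def by simp
    have "u - v \<le> inverse_transport N u - inverse_transport N v"
      by (rule inverse_transport_expanding[OF N(1)]) (use vu \<eta> in linarith)
    hence "z + \<eta> \<le> inverse_transport N u" using vu inv(1) by linarith
    hence "std_normal_cdf (z + \<eta>) \<le> std_normal_cdf (inverse_transport N u)" by (rule std_normal_cdf_mono)
    moreover have "((z + \<eta>) - z) * std_normal_density (y + \<eta>) \<le> std_normal_cdf (z + \<eta>) - std_normal_cdf z"
      by (rule std_normal_cdf_increment) (use \<eta> zy in auto)
    ultimately show ?thesis using gauss b k0 by simp
  qed
qed

lemma quantile_transport_error:
  fixes m :: nat and z :: real
  assumes m: "real m \<ge> 3 * 10^7" and z: "\<bar>z\<bar> \<le> sqrt (ln (real m))"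
  shows "\<bar>quantile (cdf (binomial_law m (1/2))) (std_normal_cdf z) - (real m / 2 + sqrt (real m) / 2 * z)
     - (z - z^3) / (24 * sqrt (real m))\<bar> \<le> 1/2 + 2 * 20^6 / real m"
proof -
  define T where "T = real m / 2 + sqrt (real m) / 2 * z + (z - z^3) / (24 * sqrt (real m))"
  define \<epsilon> where "\<epsilon> = 2 * 20^6 / real m"
  define x where "x = quantile (cdf (binomial_law m (1/2))) (std_normal_cdf z)"
  have iff: "x \<le> t \<longleftrightarrow> std_normal_cdf z \<le> cdf (binomial_law m (1/2)) t" for t
    unfolding x_def by (rule quantile_le_iff[OF real_distribution_binomial_law std_normal_cdf_bounds])
  define k where "k = \<lceil>T - \<epsilon> - 1/2\<rceil> - 1"
  have kr: "T - \<epsilon> - 3/2 \<le> of_int k" "of_int k < T - \<epsilon> - 1/2"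
    unfolding k_def by linarith+
  from sym_binom_cdf_vs_transport(1)[OF m z, folded T_def, folded \<epsilon>_def, OF kr]
  have k: "0 \<le> k" "sym_binom_cdf m (nat k) < std_normal_cdf z" by auto
  \<comment> \<open>\<open>F\<close> stays below \<open>\<Phi> z\<close> up to \<open>k + 1\<close>, so the quantile is at least \<open>k + 1\<close>.\<close>
  have low: "T - \<epsilon> - 1/2 \<le> x"
  proof (rule ccontr)
    assume "\<not> T - \<epsilon> - 1/2 \<le> x"
    hence "x < real (Suc (nat k))" using kr k(1) unfolding k_def by linarith
    hence "cdf (binomial_law m (1/2)) x \<le> sym_binom_cdf m (nat k)" by (rule cdf_binomial_law_step)
    moreover have "std_normal_cdf z \<le> cdf (binomial_law m (1/2)) x" using iff by blast
    ultimately show False using k(2) by linarith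
  qed
  define l where "l = \<lfloor>T + \<epsilon> + 1/2\<rfloor>"
  have lr: "T + \<epsilon> - 1/2 \<le> of_int l" "of_int l \<le> T + \<epsilon> + 1/2"
    unfolding l_def by linarith+
  from sym_binom_cdf_vs_transport(2)[OF m z, folded T_def, folded \<epsilon>_def, OF lr]
  have l: "0 \<le> l" "std_normal_cdf z \<le> sym_binom_cdf m (nat l)" by auto
  have "x \<le> real (nat l)" unfolding iff cdf_binomial_law_nat by (rule l(2))
  hence "x \<le> T + \<epsilon> + 1/2" using lr l(1) by simp
  hence "\<bar>x - T\<bar> \<le> 1/2 + \<epsilon>" using low by linarith
  thus ?thesis unfolding x_def T_def \<epsilon>_def by (simp add: algebra_simps)
qed

lemma threshold_sufficient:
  assumes "n \<ge> 4 * 10^7"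
  shows "sqrt (2 * pi) * 20 ^ 6 * inverse (real n) \<le> sqrt (ln (real n))"
proof -
  have n: "real n \<ge> 4 * 10^7" using assms by simp
  have "sqrt (2*pi) * 20^6 * inverse (real n) \<le> sqrt (2*pi) * 20^6 * inverse (4 * 10^7)"
    using n by (intro mult_left_mono le_imp_inverse_le) auto
  also have "\<dots> = sqrt (2*pi) * (8/5)" by simp
  also have "\<dots> = sqrt (2*pi * (8/5)^2)" by (simp only: real_sqrt_mult) simp
  also have "\<dots> \<le> sqrt 17" using pi_approx(2) by (intro real_sqrt_le_mono) (simp add: power2_eq_square)
  also have "\<dots> \<le> sqrt (ln (real n))" using ln_ge_17[of "real n"] n by (intro real_sqrt_le_mono) simp
  finally show ?thesis .
qed

text \<open>Below \<open>3 * 10^7\<close> the left-hand side exceeds \<open>5.3\<close>, whereas \<open>sqrt (ln m)\<close> stays below \<open>sqrt 28\<close>.\<close>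
lemma threshold_necessary:
  assumes "m > 0" "sqrt (2 * pi) * 20 ^ 6 * inverse (real m) \<le> sqrt (ln (real m))"
  shows "real m \<ge> 3 * 10^7"
proof (rule ccontr)
  assume "\<not> real m \<ge> 3 * 10^7"
  hence m: "real m < 3 * 10^7" "real m > 0" using assms(1) by auto
  \<comment> \<open>\<open>28 < (16/3)^2\<close>, and \<open>16/3\<close> is the left-hand side at \<open>m = 3 * 10^7\<close> with \<open>sqrt (2 pi)\<close> replaced by \<open>5/2\<close>.\<close>
  have "(2::real) ^ 28 \<le> exp 1 ^ 28" using exp_ge_add_one_self[of 1] by (intro power_mono) auto
  also have "\<dots> = exp 28" by (simp add: exp_of_nat_mult[symmetric])
  finally have "real m \<le> exp 28" using m by simp
  hence "ln (real m) \<le> 28" using m by (metis ln_exp ln_le_cancel_iff exp_gt_zero)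
  hence "sqrt (ln (real m)) \<le> sqrt 28" by (rule real_sqrt_le_mono)
  also have "sqrt 28 < 5/2 * 20^6 * inverse (3 * 10^7)"
    by (rule real_less_lsqrt) (auto simp: power2_eq_square)
  also have "\<dots> \<le> sqrt (2*pi) * 20^6 * inverse (real m)"
  proof (intro mult_mono le_imp_inverse_le)
    show "5/2 \<le> sqrt (2*pi)" using pi_approx(1) by (intro real_le_rsqrt) (simp add: power2_eq_square)
  qed (use m in auto)
  finally show False using assms(2) by simp
qed

theorem theorem1p1:
  fixes M :: "'a measure" and Z X Y :: "'a \<Rightarrow> real"
    and \<Phi> F :: "real \<Rightarrow> real" and m :: nat
  assumes "prob_space M"
    and Z: "distributed M lborel Z std_normal_density"
    and \<Phi>: "\<Phi> = cdf (distr M borel Z)"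
    and F: "F = cdf (binomial_law m (1/2))"
    and m_pos: "m > 0"
    and m: "sqrt (2 * pi) * 20 ^ 6 * inverse (real m) \<le> sqrt (ln (real m))"
    and Y: "Y = (\<lambda>\<omega>. real m / 2 + sqrt (real m) / 2 * Z \<omega>)"
    and X: "X = (\<lambda>\<omega>. quantile F (\<Phi> (Z \<omega>)))"
  shows "(\<forall>n::nat. n \<ge> 4 * 10 ^ 7 \<longrightarrow>
            sqrt (2 * pi) * 20 ^ 6 * inverse (real n) \<le> sqrt (ln (real n))) \<and>
         distributed M lborel Y (normal_density (real m / 2) (sqrt (real m / 4))) \<and>
         X \<in> borel_measurable M \<and> distr M borel X = binomial_law m (1/2) \<and>
         (\<forall>\<omega>\<in>space M. \<bar>Z \<omega>\<bar> \<le> sqrt (ln (real m)) \<longrightarrow>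
            \<bar>X \<omega> - Y \<omega> - (Z \<omega> - Z \<omega> ^ 3) / (24 * sqrt (real m))\<bar>
              \<le> 1 / 2 + 2 * 20 ^ 6 / real m) \<and>
         (\<forall>\<omega>\<in>space M. \<bar>Z \<omega>\<bar> \<le> sqrt (ln (real m)) \<longrightarrow>
            \<bar>X \<omega> - Y \<omega>\<bar>
              \<le> 1 / 2 + 1 / 24 * sqrt (ln (real m) / real m)
                + 1 / 24 * (\<bar>Z \<omega>\<bar> ^ 3 / sqrt (real m)) + 2 * 20 ^ 6 / real m)"
proof (intro conjI)
  interpret prob_space M by fact
  have Z_rv: "random_variable borel Z"
    using distributed_measurable[OF Z] by simp
  have "distr M borel Z = distr M lborel Z" by (rule distr_cong) simp_all
  also have "\<dots> = density lborel std_normal_density" by (rule distributed_distr_eq_density[OF Z])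
  finally have cdf_Z: "cdf (distr M borel Z) = std_normal_cdf" unfolding std_normal_cdf_def by simp
  have \<Phi>_eq: "\<Phi> = std_normal_cdf" unfolding \<Phi> cdf_Z ..
  have m_large: "real m \<ge> 3 * 10^7" by (rule threshold_necessary[OF m_pos m])
  show "\<forall>n::nat. n \<ge> 4 * 10 ^ 7 \<longrightarrow> sqrt (2 * pi) * 20 ^ 6 * inverse (real n) \<le> sqrt (ln (real n))"
    using threshold_sufficient by blast
  have "distributed M lborel (\<lambda>\<omega>. real m / 2 + sqrt (real m) / 2 * Z \<omega>)
      (normal_density (real m / 2 + sqrt (real m) / 2 * 0) (\<bar>sqrt (real m) / 2\<bar> * 1))"
    by (rule normal_density_affine[OF Z]) (use m_pos in auto)
  moreover have "\<bar>sqrt (real m) / 2\<bar> * 1 = sqrt (real m / 4)" by (simp add: real_sqrt_divide)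
  ultimately show "distributed M lborel Y (normal_density (real m / 2) (sqrt (real m / 4)))"
    unfolding Y by simp
  show "X \<in> borel_measurable M" "distr M borel X = binomial_law m (1/2)"
    unfolding X F \<Phi>_eq by (rule quantile_transform[OF Z_rv cdf_Z real_distribution_binomial_law])+
  show error: "\<forall>\<omega>\<in>space M. \<bar>Z \<omega>\<bar> \<le> sqrt (ln (real m)) \<longrightarrow>
            \<bar>X \<omega> - Y \<omega> - (Z \<omega> - Z \<omega> ^ 3) / (24 * sqrt (real m))\<bar>
              \<le> 1 / 2 + 2 * 20 ^ 6 / real m"
    unfolding X Y F \<Phi>_eq using quantile_transport_error[OF m_large] by blast
  show "\<forall>\<omega>\<in>space M. \<bar>Z \<omega>\<bar> \<le> sqrt (ln (real m)) \<longrightarrow>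
            \<bar>X \<omega> - Y \<omega>\<bar>
              \<le> 1 / 2 + 1 / 24 * sqrt (ln (real m) / real m)
                + 1 / 24 * (\<bar>Z \<omega>\<bar> ^ 3 / sqrt (real m)) + 2 * 20 ^ 6 / real m"
  proof (intro ballI impI)
    fix \<omega> assume \<omega>: "\<omega> \<in> space M" and z: "\<bar>Z \<omega>\<bar> \<le> sqrt (ln (real m))"
    define r where "r = sqrt (real m)"
    have r: "r > 0" unfolding r_def using m_pos by simp
    have "\<bar>(Z \<omega> - Z \<omega> ^ 3) / (24 * r)\<bar> = \<bar>Z \<omega> - Z \<omega> ^ 3\<bar> / (24 * r)"
      unfolding abs_divide using r by simp
    also have "\<dots> \<le> (sqrt (ln (real m)) + \<bar>Z \<omega>\<bar> ^ 3) / (24 * r)"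
    proof (intro divide_right_mono)
      have "\<bar>Z \<omega> - Z \<omega> ^ 3\<bar> \<le> \<bar>Z \<omega>\<bar> + \<bar>Z \<omega>\<bar> ^ 3"
        using abs_triangle_ineq4[of "Z \<omega>" "Z \<omega> ^ 3"] by (simp add: power_abs)
      thus "\<bar>Z \<omega> - Z \<omega> ^ 3\<bar> \<le> sqrt (ln (real m)) + \<bar>Z \<omega>\<bar> ^ 3" using z by linarith
    qed (use r in simp)
    also have "\<dots> = 1 / 24 * (sqrt (ln (real m)) / r) + 1 / 24 * (\<bar>Z \<omega>\<bar> ^ 3 / r)"
      by (simp add: add_divide_distrib)
    also have "sqrt (ln (real m)) / r = sqrt (ln (real m) / real m)" unfolding r_def by (rule real_sqrt_divide[symmetric])
    finally have "\<bar>(Z \<omega> - Z \<omega> ^ 3) / (24 * r)\<bar>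
       \<le> 1 / 24 * sqrt (ln (real m) / real m) + 1 / 24 * (\<bar>Z \<omega>\<bar> ^ 3 / r)" .
    moreover have "\<bar>X \<omega> - Y \<omega> - (Z \<omega> - Z \<omega> ^ 3) / (24 * r)\<bar> \<le> 1 / 2 + 2 * 20 ^ 6 / real m"
      using error \<omega> z unfolding r_def by blast
    moreover have "\<bar>d\<bar> \<le> h + a + b + c" if "\<bar>t\<bar> \<le> a + b" "\<bar>d - t\<bar> \<le> h + c" for d t a b c h :: real
      using that by linarith
    ultimately show "\<bar>X \<omega> - Y \<omega>\<bar> \<le> 1 / 2 + 1 / 24 * sqrt (ln (real m) / real m)
                + 1 / 24 * (\<bar>Z \<omega>\<bar> ^ 3 / sqrt (real m)) + 2 * 20 ^ 6 / real m"
      unfolding r_def by blast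
  qed
qed

end
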